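(* Let $0<\underline q<\bar q<1$ be constants. For each $n$ let $C(n)\in\mathbb Z_{\ge1}$ and $q^{(n)}\in[\underline q,\bar q]^n$, and let $\pi_{\mathsf{FA}}$ be a fair allocation policy for the instance with $n$ threats, capacity $C(n)$ and difficulties $q^{(n)}$. Then, as $n\to\infty$: (1) if $C(n)=n$, then $\mathbb E[T^{\pi_{\mathsf{FA}}}]=\Theta(\ln^*n)$; (2) if $C(n)>n$, then $\mathbb E[T^{\pi_{\mathsf{FA}}}]=O(\ln^*n)$; (3) if $C(n)<n$, then $\mathbb E[T^{\pi_{\mathsf{FA}}}]=\frac1{C(n)}\sum_{i=1}^n\frac1{1-q_i^{(n)}}+O(\ln^*C(n))$. Here, for $m\in\mathbb Z_{\ge1}$, $\ln^*(m)=\min\{k\in\mathbb Z_{\ge0}:\ln^{(k)}(m)\le1\}$ is the iterated logarithm, $\ln^{(k)}$ being the $k$-fold composition of $\ln$.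
   Context: Model. An instance has $n\ge1$ threats $[n]=\{1,\dots,n\}$, a per-round capacity $C\in\mathbb Z_{\ge1}$ of effectors, and difficulties $q=(q_i)\in[0,1)^n$, where $q_i$ is the probability that a single effector fails to neutralize threat $i$. Demands $L_1,\dots,L_n$ are independent, $L_i\sim\mathrm{Geom}(1-q_i)$ on $\{1,2,\dots\}$, i.e. $\Pr(L_i>k)=q_i^k$. $\mathcal M_t\subseteq[n]$ is the set of active threats at the start of round $t$, $\mathcal M_1=[n]$. A policy is $\pi=(\pi_t)_{t\ge1}$, where $\pi_t$ maps each subset $\mathcal M\subseteq[n]$ to a vector $\pi_t(\mathcal M)\in\mathbb Z_{\ge0}^n$ with $\sum_{i\in[n]}[\pi_t(\mathcal M)]_i\le C$ and, for every nonempty $\mathcal M$ and every $t$, $\sum_{i\in\mathcal M}[\pi_t(\mathcal M)]_i=C$; $\Pi$ is the set of all such policies. Under $\pi$, the round-$t$ allocation is $x^t=\pi_t(\mathcal M_t)$ and $\mathcal M_{t+1}=\{i\in\mathcal M_t:\sum_{\ell=1}^t x_i^\ell<L_i\}$. The defusing time is $T^\pi=\min\{t:\sum_{\ell=1}^t x_i^\ell\ge L_i\ \forall i\in[n]\}$. Fair allocation. For nonempty $\mathcal M\subseteq[n]$, $x\in\mathbb Z_{\ge0}^n$ is fair for $\mathcal M$ if $\sum_{i\in\mathcal M}x_i=C$, $x_i=0$ for $i\notin\mathcal M$, and $|x_i-x_j|\in\{0,1\}$ for all $i,j\in\mathcal M$. A fair allocation policy is a $\pi\in\Pi$ such that $\pi_t(\mathcal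 M)$ is fair for $\mathcal M$ for every nonempty $\mathcal M\subseteq[n]$ and every $t\ge1$. The statement is for arbitrary fair allocation policies. *)

theory Defs
  imports "HOL-Probability.Probability" "HOL-Library.Landau_Symbols"
begin

text \<open>
  Threats are \<open>{1..n}\<close> and rounds are \<open>1, 2, \<dots>\<close>. A vector indexed by the threats is a function
  on \<open>nat\<close> whose values outside \<open>{1..n}\<close> are never used; likewise a policy is never used at round
  \<open>0\<close>.
\<close>

type_synonym policy = "nat \<Rightarrow> nat set \<Rightarrow> nat \<Rightarrow> nat"

definition policies :: "nat \<Rightarrow> nat \<Rightarrow> policy set" where
  "policies n C = {\<pi>. \<forall>t\<ge>1. \<forall>M\<subseteq>{1..n}.
     (\<Sum>i\<in>{1..n}. \<pi> t M i) \<le> C \<and> (M \<noteq> {} \<longrightarrow> (\<Sum>i\<in>M. \<pi> t M i) = C)}"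

definition fair_allocation :: "nat \<Rightarrow> nat \<Rightarrow> nat set \<Rightarrow> (nat \<Rightarrow> nat) \<Rightarrow> bool" where
  "fair_allocation n C M x \<longleftrightarrow>
     (\<Sum>i\<in>M. x i) = C \<and>
     (\<forall>i\<in>{1..n} - M. x i = 0) \<and>
     (\<forall>i\<in>M. \<forall>j\<in>M. \<bar>int (x i) - int (x j)\<bar> \<in> {0, 1})"

definition fair_policies :: "nat \<Rightarrow> nat \<Rightarrow> policy set" where
  "fair_policies n C = {\<pi> \<in> policies n C.
     \<forall>t\<ge>1. \<forall>M\<subseteq>{1..n}. M \<noteq> {} \<longrightarrow> fair_allocation n C M (\<pi> t M)}"

text \<open>
  The set of threats active at the start of round \<open>t \<ge> 1\<close> under policy \<open>\<pi>\<close> when the demands take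
  the values \<open>L\<close>; the sum over \<open>l\<close> is the number of effectors allocated to threat \<open>i\<close> in the
  rounds before \<open>t\<close>.
\<close>

fun active :: "nat \<Rightarrow> policy \<Rightarrow> (nat \<Rightarrow> nat) \<Rightarrow> nat \<Rightarrow> nat set" where
  "active n \<pi> L t =
     (if t \<le> 1 then {1..n}
      else {i \<in> active n \<pi> L (t - 1). (\<Sum>l\<in>{1..t - 1}. \<pi> l (active n \<pi> L l) i) < L i})"

declare active.simps [simp del]

definition allocation :: "nat \<Rightarrow> policy \<Rightarrow> (nat \<Rightarrow> nat) \<Rightarrow> nat \<Rightarrow> nat \<Rightarrow> nat" where
  "allocation n \<pi> L t = \<pi> t (active n \<pi> L t)"

text \<open>
  For \<open>\<pi> \<in> policies n C\<close> with \<open>C \<ge> 1\<close> the minimum is attained: while some threat is active, every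
  round allocates \<open>C\<close> effectors to active threats.
\<close>

definition defusing_time :: "nat \<Rightarrow> policy \<Rightarrow> (nat \<Rightarrow> nat) \<Rightarrow> nat" where
  "defusing_time n \<pi> L = (LEAST t. \<forall>i\<in>{1..n}. (\<Sum>l\<in>{1..t}. allocation n \<pi> L l i) \<ge> L i)"

text \<open>
  The joint law of the demands. The library's \<open>geometric_pmf p\<close> lives on \<open>{0, 1, \<dots>}\<close>, hence the
  shift by \<open>Suc\<close>. Coordinates outside \<open>{1..n}\<close> are constantly \<open>0\<close>.
\<close>

definition demands :: "nat \<Rightarrow> (nat \<Rightarrow> real) \<Rightarrow> (nat \<Rightarrow> nat) pmf" where
  "demands n q = Pi_pmf {1..n} 0 (\<lambda>i. map_pmf Suc (geometric_pmf (1 - q i)))"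

lemma indep_vars_demands:
  "prob_space.indep_vars (measure_pmf (demands n q)) (\<lambda>_. count_space UNIV) (\<lambda>i L. L i) {1..n}"
  unfolding demands_def by (rule indep_vars_Pi_pmf) simp

lemma prob_demand_greater:
  assumes i: "i \<in> {1..n}" and q: "0 \<le> q i" "q i < 1"
  shows "measure_pmf.prob (demands n q) {L. L i > k} = q i ^ k"
proof -
  let ?g = "geometric_pmf (1 - q i)"
  have "measure_pmf.prob (demands n q) {L. L i > k} =
      measure_pmf.prob (map_pmf (\<lambda>L. L i) (demands n q)) {k<..}"
    by (simp add: vimage_def)
  also have "map_pmf (\<lambda>L. L i) (demands n q) = map_pmf Suc ?g"
    using i unfolding demands_def by (subst Pi_pmf_component) auto
  also have "measure_pmf.prob (map_pmf Suc ?g) {k<..} = measure_pmf.prob ?g (- {..<k})"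
    by (auto intro!: arg_cong[where f = "measure_pmf.prob ?g"])
  also have "\<dots> = 1 - measure_pmf.prob ?g {..<k}"
    by (subst measure_pmf.prob_compl [symmetric]) (auto simp: Compl_eq_Diff_UNIV)
  also have "measure_pmf.prob ?g {..<k} = (\<Sum>j<k. q i ^ j * (1 - q i))"
    using q by (simp add: measure_measure_pmf_finite)
  also have "\<dots> = 1 - q i ^ k"
    using q by (simp add: sum_distrib_right [symmetric] sum_gp_strict)
  finally show ?thesis by simp
qed

text \<open>
  Being a Bochner integral, this is \<open>0\<close> if the defusing time is not integrable; integrability has
  to be stated separately.
\<close>

definition expected_defusing_time :: "nat \<Rightarrow> (nat \<Rightarrow> real) \<Rightarrow> policy \<Rightarrow> real" where
  "expected_defusing_time n q \<pi> =
     measure_pmf.expectation (demands n q) (\<lambda>L. real (defusing_time n \<pi> L))"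

definition ln_star :: "nat \<Rightarrow> nat" where
  "ln_star m = (LEAST k. (ln ^^ k) (real m) \<le> 1)"

end

theory Submission
  imports Defs
begin

text \<open>
  By memorylessness of the geometric law the active sets form a Markov chain in which threat \<open>i\<close>
  survives a round with probability \<open>q i ^ x i\<close>, independently of the others. The expected
  absorption time is bounded by potentials: a nonnegative function of the active set that drops by
  at least 1 per round in expectation bounds it from above, and one that vanishes on the empty set
  and drops by at most 1 bounds it from below.

  The workload \<open>(\<Sum>i\<in>M. 1 / (1 - q i)) / C\<close> drops by at most 1 under every policy, and by exactly 1
  as long as at least \<open>C\<close> threats are active, because then no two effectors share a threat. With
  \<open>N \<le> C\<close> active threats each one receives about \<open>C / N\<close> effectors, so \<open>N\<close> is replaced by roughly
  \<open>N * exp (- \<beta> * C / N)\<close>. The number of iterations of this map until \<open>N < 1\<close> is of order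
  \<open>ln_star C\<close> and, up to constants, a potential for both bounds: Markov's inequality shows that a
  round advances by one iteration with probability bounded away from 0, and a Chernoff bound that it
  rarely advances by more.
\<close>

subsection \<open>The iterated logarithm\<close>

text \<open>Once an iterate is at most 1, later logarithms may be taken outside the positive reals
  and mean nothing; hence only some \<open>j \<le> k\<close> is claimed.\<close>

lemma ln_star_le:
  assumes "x \<le> (exp ^^ k) 1"
  shows "\<exists>j\<le>k. (ln ^^ j) (x::real) \<le> 1"
  using assms
proof (induction k arbitrary: x)
  case 0
  then show ?case by simp
next
  case (Suc k)
  show ?case
  proof (cases "x \<le> 1")
    case True
    then show ?thesis by (intro exI[of _ 0]) simp
  next
    case False
    then have "ln x \<le> (exp ^^ k) 1"
      using Suc.prems by (subst ln_le_cancel_iff[symmetric] exp_le_cancel_iff[symmetric]; simp)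
    then obtain j where "j \<le> k" "(ln ^^ j) (ln x) \<le> 1"
      using Suc.IH by blast
    then show ?thesis
      by (intro exI[of _ "Suc j"]) (simp add: funpow_swap1)
  qed
qed

text \<open>While the iterates exceed 1, every logarithm can be undone by \<open>exp\<close>, one
  level of the tower at a time.\<close>

lemma le_exp_tower:
  assumes "\<And>i. i < j \<Longrightarrow> (ln ^^ i) x > 1" and "(ln ^^ j) (x::real) \<le> 1"
  shows "x \<le> (exp ^^ j) 1"
  using assms
proof (induction j arbitrary: x)
  case 0
  then show ?case by simp
next
  case (Suc j)
  have "x > 1" using Suc.prems(1)[of 0] by simp
  have "ln x \<le> (exp ^^ j) 1"
  proof (rule Suc.IH)
    show "(ln ^^ i) (ln x) > 1" if "i < j" for i
      using Suc.prems(1)[of "Suc i"] that by (simp add: funpow_swap1)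
    show "(ln ^^ j) (ln x) \<le> 1"
      using Suc.prems(2) by (simp add: funpow_swap1)
  qed
  with \<open>x > 1\<close> show ?case
    by (metis exp_le_cancel_iff exp_ln funpow.simps(2) comp_apply less_trans zero_less_one)
qed

lemma exp_tower_ge: "real k + 1 \<le> (exp ^^ k) 1"
proof (induction k)
  case (Suc k)
  have "real (Suc k) + 1 \<le> 1 + (exp ^^ k) 1" using Suc by simp
  also have "\<dots> \<le> exp ((exp ^^ k) 1)" by (rule exp_ge_add_one_self)
  finally show ?case by simp
qed simp

text \<open>Ensures that the minimum in \<open>ln_star\<close> is attained.\<close>

lemma exp_tower_unbounded: "\<exists>k. x \<le> (exp ^^ k) (1::real)"
proof -
  obtain k where "x \<le> real k" using real_arch_simple by blast
  with exp_tower_ge[of k] show ?thesis by (intro exI[of _ k]) linarith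
qed

lemma exp_tower_mono: "x \<le> y \<Longrightarrow> (exp ^^ k) x \<le> (exp ^^ k) (y::real)"
  by (induction k) auto

text \<open>Together with \<open>le_exp_tower_ln_star\<close> this identifies
  \<open>ln_star m\<close> as the least height of an exponential tower reaching \<open>m\<close>;
  later estimates only compare towers.\<close>

lemma ln_star_least:
  assumes "real m \<le> (exp ^^ k) 1"
  shows "ln_star m \<le> k"
  using ln_star_le[OF assms] unfolding ln_star_def by (meson Least_le le_trans)

lemma le_exp_tower_ln_star: "real m \<le> (exp ^^ ln_star m) 1"
proof (rule le_exp_tower)
  obtain k where "(ln ^^ k) (real m) \<le> 1"
    using exp_tower_unbounded[of "real m"] ln_star_le by blast
  then show "(ln ^^ ln_star m) (real m) \<le> 1"
    unfolding ln_star_def by (rule LeastI)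
  show "(ln ^^ i) (real m) > 1" if "i < ln_star m" for i
    using not_less_Least that unfolding ln_star_def by (metis not_le)
qed

lemma ln_star_ge_1: "m \<ge> 2 \<Longrightarrow> ln_star m \<ge> 1"
  using le_exp_tower_ln_star[of m] by (cases "ln_star m") auto

subsection \<open>Iterated decay\<close>

text \<open>One round with \<open>y\<close> active threats and about \<open>m / y\<close> effectors
  on each. The extra factor \<open>a < 1\<close> absorbs rounding losses and makes the iterates
  shrink geometrically.\<close>

definition decay :: "real \<Rightarrow> real \<Rightarrow> real \<Rightarrow> real \<Rightarrow> real" where
  "decay a \<beta> m y = a * y * exp (- (\<beta> * m / y))"

text \<open>The threshold is 1 because a number of threats below 1 is 0.\<close>

definition decay_steps :: "real \<Rightarrow> real \<Rightarrow> real \<Rightarrow> real \<Rightarrow> nat" where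
  "decay_steps a \<beta> m y = (LEAST k. (decay a \<beta> m ^^ k) y < 1)"

context
  fixes a \<beta> :: real
  assumes a: "0 < a" "a < 1" and \<beta>: "0 < \<beta>"
begin

lemma decay_mono:
  assumes "0 \<le> m" "0 \<le> x" "x \<le> y"
  shows "decay a \<beta> m x \<le> decay a \<beta> m y"
proof (cases "x = 0")
  case False
  have "\<beta> * m / y \<le> \<beta> * m / x"
    using assms False \<beta> by (intro divide_left_mono) auto
  then show ?thesis
    unfolding decay_def using assms a by (intro mult_mono) auto
qed (use assms a in \<open>auto simp: decay_def\<close>)

lemma decay_nonneg: "0 \<le> y \<Longrightarrow> 0 \<le> decay a \<beta> m y"
  using a by (simp add: decay_def)

lemma decay_le:
  assumes "0 \<le> m" "0 \<le> y"
  shows "decay a \<beta> m y \<le> a * y"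
proof -
  have "exp (- (\<beta> * m / y)) \<le> 1" using assms \<beta> by simp
  then show ?thesis
    unfolding decay_def using assms a by (intro mult_left_le) auto
qed

lemma decay_funpow_nonneg: "0 \<le> y \<Longrightarrow> 0 \<le> (decay a \<beta> m ^^ k) y"
  by (induction k) (auto intro: decay_nonneg)

lemma decay_funpow_mono:
  assumes "0 \<le> m" "0 \<le> x" "x \<le> y"
  shows "(decay a \<beta> m ^^ k) x \<le> (decay a \<beta> m ^^ k) y"
  by (induction k) (use assms in \<open>auto intro!: decay_mono decay_funpow_nonneg\<close>)

lemma decay_funpow_le:
  assumes "0 \<le> m" "0 \<le> y"
  shows "(decay a \<beta> m ^^ k) y \<le> a ^ k * y"
proof (induction k)
  case (Suc k)
  have "(decay a \<beta> m ^^ Suc k) y \<le> a * (decay a \<beta> m ^^ k) y"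
    using decay_le[OF assms(1) decay_funpow_nonneg[OF assms(2)]] by simp
  also have "\<dots> \<le> a * (a ^ k * y)" using Suc a by simp
  finally show ?case by simp
qed simp

lemma decay_funpow_less_1:
  assumes "0 \<le> m" "0 \<le> y"
  shows "\<exists>k. (decay a \<beta> m ^^ k) y < 1"
proof (cases "y = 0")
  case True
  then show ?thesis by (intro exI[of _ 0]) simp
next
  case False
  then obtain k where "a ^ k < 1 / y"
    using real_arch_pow_inv[of "1 / y" a] a assms by auto
  then have "a ^ k * y < 1" using False assms by (simp add: field_simps)
  then show ?thesis using decay_funpow_le[OF assms, of k] by (meson le_less_trans)
qed

lemma decay_funpow_steps:
  assumes "0 \<le> m" "0 \<le> y"
  shows "(decay a \<beta> m ^^ decay_steps a \<beta> m y) y < 1"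
  unfolding decay_steps_def using decay_funpow_less_1[OF assms] by (rule LeastI_ex)

lemma decay_steps_le: "(decay a \<beta> m ^^ k) y < 1 \<Longrightarrow> decay_steps a \<beta> m y \<le> k"
  unfolding decay_steps_def by (rule Least_le)

lemma decay_steps_eq_0: "y < 1 \<Longrightarrow> decay_steps a \<beta> m y = 0"
  using decay_steps_le[where k = 0] by fastforce

lemma decay_steps_mono:
  assumes "0 \<le> m" "0 \<le> x" "x \<le> y"
  shows "decay_steps a \<beta> m x \<le> decay_steps a \<beta> m y"
proof (rule decay_steps_le)
  have "(decay a \<beta> m ^^ decay_steps a \<beta> m y) x \<le> (decay a \<beta> m ^^ decay_steps a \<beta> m y) y"
    using assms by (rule decay_funpow_mono)
  also have "\<dots> < 1" using assms by (intro decay_funpow_steps) auto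
  finally show "(decay a \<beta> m ^^ decay_steps a \<beta> m y) x < 1" .
qed

text \<open>Zero iterations do not suffice for \<open>1 \<le> y\<close>, so the count begins with
  one application of \<open>decay\<close>.\<close>

lemma decay_steps_Suc:
  assumes "0 \<le> m" "1 \<le> y"
  shows "decay_steps a \<beta> m y = Suc (decay_steps a \<beta> m (decay a \<beta> m y))"
  unfolding decay_steps_def
  by (subst Least_Suc[of _ "decay_steps a \<beta> m y"])
     (use assms decay_funpow_steps[of m y] in \<open>auto simp: funpow_swap1\<close>)

text \<open>Every step loses at least a factor \<open>a\<close>, so needing more than
  \<open>k\<close> steps forces \<open>y\<close> to be exponentially large in \<open>k\<close>. The
  lower drift bound uses this to control the cost of a rare event.\<close>

lemma power_le_of_decay_steps:
  assumes "0 \<le> m" "0 \<le> y" "k < decay_steps a \<beta> m y"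
  shows "1 \<le> a ^ k * y"
proof -
  have "1 \<le> (decay a \<beta> m ^^ k) y"
    using not_less_Least[of k] assms(3) unfolding decay_steps_def by (metis not_le)
  also have "\<dots> \<le> a ^ k * y" using assms by (intro decay_funpow_le) auto
  finally show ?thesis .
qed

text \<open>In terms of the ratio \<open>r = m / y\<close>, a decay step is \<open>r \<mapsto> r * exp (\<beta> * r) / a\<close>.\<close>

lemma decay_funpow_ratio:
  assumes "0 < m"
  shows "0 < ((\<lambda>r. r * exp (\<beta> * r) / a) ^^ k) 1 \<and>
    (decay a \<beta> m ^^ k) m = m / ((\<lambda>r. r * exp (\<beta> * r) / a) ^^ k) 1"
proof (induction k)
  case (Suc k)
  then show ?case using assms a by (simp add: decay_def exp_minus field_simps)
qed simp

text \<open>The ratio \<open>r\<close> grows at least geometrically until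
  \<open>\<beta> * r \<ge> 1\<close>; from then on each step exponentiates
  \<open>\<beta> * r\<close> at least once. So a step gains a tower level, up to a constant number
  of steps.\<close>

lemma decay_steps_le_ln_star:
  "\<exists>A. \<forall>m\<ge>1. decay_steps a \<beta> (real m) (real m) \<le> A + ln_star m"
proof -
  define h where "h = (\<lambda>r. r * exp (\<beta> * r) / a)"
  have pos: "0 < (h ^^ k) 1" for k
    using decay_funpow_ratio[of 1 k] by (simp add: h_def)
  have h_ge: "r / a \<le> h r" if "0 < r" for r
    unfolding h_def using that \<beta> a by (intro divide_right_mono) auto
  have grow: "(h ^^ k) r \<ge> r / a ^ k \<and> (h ^^ k) r > 0" if "0 < r" for k r
  proof (induction k)
    case (Suc k)
    have "r / a ^ Suc k = (r / a ^ k) / a" by simp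
    also have "\<dots> \<le> (h ^^ k) r / a" using Suc a by (intro divide_right_mono) auto
    also have "\<dots> \<le> h ((h ^^ k) r)" using Suc by (intro h_ge) auto
    finally show ?case using Suc a by (auto simp: h_def)
  qed (use that in simp)
  \<comment> \<open>\<open>k0\<close> steps of growth by \<open>1 / a\<close> lift
    \<open>\<beta> * r\<close> to the base 1 of the tower.\<close>
  obtain k0 where "a ^ k0 < \<beta>" using real_arch_pow_inv[of \<beta> a] a \<beta> by auto
  then have "1 < \<beta> * (1 / a ^ k0)" using a by (simp add: field_simps)
  also have "\<dots> \<le> \<beta> * (h ^^ k0) 1" using grow[of 1 k0] \<beta> by (intro mult_left_mono) auto
  finally have k0: "1 \<le> \<beta> * (h ^^ k0) 1" by simp
  have tower: "(exp ^^ j) 1 \<le> \<beta> * (h ^^ (j + k0)) 1" for j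
  proof (induction j)
    case (Suc j)
    define r where "r = (h ^^ (j + k0)) 1"
    have "1 \<le> (exp ^^ j) (1::real)" using exp_tower_ge[of j] by simp
    then have r1: "1 \<le> \<beta> * r" using Suc by (simp add: r_def)
    have "(exp ^^ Suc j) 1 \<le> exp (\<beta> * r)" using Suc by (simp add: r_def)
    also have "\<dots> \<le> \<beta> * r * exp (\<beta> * r) / a"
    proof -
      have "1 \<le> \<beta> * r / a" using r1 a by (simp add: field_simps)
      from mult_right_mono[OF this, of "exp (\<beta> * r)"] show ?thesis by simp
    qed
    also have "\<dots> = \<beta> * (h ^^ (Suc j + k0)) 1" by (simp add: h_def r_def)
    finally show ?case .
  qed (use k0 in simp)
  \<comment> \<open>Another \<open>k1\<close> steps pay for the factor \<open>\<beta>\<close>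
    between \<open>\<beta> * r\<close> and \<open>r\<close>.\<close>
  obtain k1 where k1: "a ^ k1 < 1 / \<beta>" using real_arch_pow_inv[of "1 / \<beta>" a] a \<beta> by auto
  have "decay_steps a \<beta> (real m) (real m) \<le> (k0 + k1) + ln_star m" if "m \<ge> 1" for m
  proof (rule decay_steps_le)
    define r where "r = (h ^^ (ln_star m + k0)) 1"
    have "real m \<le> \<beta> * r"
      unfolding r_def using le_exp_tower_ln_star[of m] tower[of "ln_star m"] by linarith
    also have "\<dots> < r / a ^ k1"
      using k1 \<beta> a pos[of "ln_star m + k0"] by (simp add: field_simps r_def)
    also have "\<dots> \<le> (h ^^ k1) r" using grow[of r k1] pos by (simp add: r_def)
    also have "\<dots> = (h ^^ (k0 + k1 + ln_star m)) 1"
      by (simp add: r_def funpow_add[THEN fun_cong, symmetric, unfolded comp_def] ac_simps)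
    finally show "(decay a \<beta> (real m) ^^ (k0 + k1 + ln_star m)) (real m) < 1"
      using decay_funpow_ratio[of "real m" "k0 + k1 + ln_star m"] that
      by (simp add: h_def[symmetric])
  qed
  then show ?thesis by blast
qed

text \<open>For \<open>r \<ge> 1\<close> a step is at most \<open>exp (E * r)\<close>. Rescaled by
  \<open>E\<close> it stays below two nested exponentials, the outer one absorbing the factor
  \<open>E\<close>; this is the coefficient 2.\<close>

lemma ln_star_le_decay_steps:
  "\<exists>A. \<forall>m\<ge>1. ln_star m \<le> A + 2 * decay_steps a \<beta> (real m) (real m)"
proof -
  define h where "h = (\<lambda>r. r * exp (\<beta> * r) / a)"
  \<comment> \<open>\<open>E\<close> dominates the three terms of \<open>ln (h r)\<close>, namely
    \<open>ln r\<close>, \<open>\<beta> * r\<close> and \<open>- ln a\<close>, each at most a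
    multiple of \<open>r\<close>.\<close>
  define E where "E = 1 + \<beta> - ln a"
  have ln_a: "ln a < 0" using a by simp
  then have E1: "1 \<le> E" using \<beta> by (simp add: E_def)
  have h_le: "h r \<le> exp (E * r)" if "1 \<le> r" for r
  proof -
    have "h r = exp (ln r + \<beta> * r - ln a)"
      using that a by (simp add: h_def exp_add exp_diff)
    also have "\<dots> \<le> exp (E * r)"
    proof -
      have "ln r \<le> r" using that ln_le_minus_one[of r] by simp
      moreover have "- ln a \<le> - ln a * r" using that ln_a by (simp add: mult_le_cancel_left1)
      ultimately show ?thesis by (simp add: E_def algebra_simps)
    qed
    finally show ?thesis .
  qed
  have h_ge1: "1 \<le> h r" if "1 \<le> r" for r
  proof -
    have "1 * 1 \<le> r * exp (\<beta> * r)" using that \<beta> by (intro mult_mono) auto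
    then show ?thesis using a by (simp add: h_def field_simps)
  qed
  have exp2: "E * exp x \<le> exp (exp x)" if "E \<le> x" for x
  proof -
    have x: "x > 0" using that E1 by simp
    \<comment> \<open>This yields \<open>2 * x - 1 \<le> exp x\<close>, and then
      \<open>ln x + x \<le> exp x\<close> by \<open>ln x \<le> x - 1\<close>.\<close>
    have "2 * x - 1 \<le> (1 + x / 2)\<^sup>2"
    proof -
      have "0 \<le> (x / 2 - 1)\<^sup>2" by simp
      then show ?thesis by (simp add: power2_eq_square algebra_simps)
    qed
    also have "\<dots> \<le> (exp (x / 2))\<^sup>2" using x by (intro power_mono) (auto simp: exp_ge_add_one_self)
    also have "\<dots> = exp x" by (simp flip: exp_double)
    finally have "ln x + x \<le> exp x" using ln_le_minus_one[OF x] by linarith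
    then have "exp (ln x + x) \<le> exp (exp x)" by simp
    then have "x * exp x \<le> exp (exp x)" using x by (simp add: exp_add)
    moreover have "E * exp x \<le> x * exp x" using that by simp
    ultimately show ?thesis by linarith
  qed
  have tower: "1 \<le> (h ^^ k) 1 \<and> E * (h ^^ k) 1 \<le> (exp ^^ (2 * k)) E" for k
  proof (induction k)
    case (Suc k)
    define r where "r = (h ^^ k) 1"
    have r: "1 \<le> r" "E * r \<le> (exp ^^ (2 * k)) E" using Suc by (auto simp: r_def)
    have "E * h r \<le> E * exp (E * r)" using h_le[OF r(1)] E1 by simp
    also have "\<dots> \<le> exp (exp (E * r))" using E1 r(1) by (intro exp2) simp
    also have "\<dots> \<le> (exp ^^ (2 * Suc k)) E" using r(2) by simp
    finally show ?case using h_ge1[OF r(1)] by (simp add: r_def)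
  qed simp
  obtain j where j: "E \<le> (exp ^^ j) 1" using exp_tower_unbounded by blast
  have "ln_star m \<le> j + 2 * decay_steps a \<beta> (real m) (real m)" if "m \<ge> 1" for m
  proof (rule ln_star_least)
    define u where "u = decay_steps a \<beta> (real m) (real m)"
    have "(decay a \<beta> (real m) ^^ u) (real m) < 1"
      unfolding u_def by (rule decay_funpow_steps) auto
    then have "real m < (h ^^ u) 1"
      using decay_funpow_ratio[of "real m" u] that by (simp add: h_def field_simps)
    also have "\<dots> \<le> E * (h ^^ u) 1" using E1 tower[of u] by simp
    also have "\<dots> \<le> (exp ^^ (2 * u)) E" using tower by blast
    also have "\<dots> \<le> (exp ^^ (2 * u)) ((exp ^^ j) 1)" using j by (rule exp_tower_mono)
    also have "\<dots> = (exp ^^ (2 * u + j)) 1" by (simp add: funpow_add)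
    finally show "real m \<le> (exp ^^ (j + 2 * decay_steps a \<beta> (real m) (real m))) 1"
      by (simp add: u_def add.commute)
  qed
  then show ?thesis by blast
qed

end

subsection \<open>The Markov chain of active sets\<close>

definition retain :: "('a \<Rightarrow> real) \<Rightarrow> 'a set \<Rightarrow> 'a set pmf" where
  "retain p M = map_pmf (\<lambda>b. {i \<in> M. b i}) (Pi_pmf M False (\<lambda>i. bernoulli_pmf (p i)))"

lemma set_pmf_retain: "set_pmf (retain p M) \<subseteq> Pow M"
  by (auto simp: retain_def)

lemma finite_set_pmf_retain: "finite M \<Longrightarrow> finite (set_pmf (retain p M))"
  using set_pmf_retain finite_subset by (metis finite_Pow_iff)

lemma integrable_retain:
  fixes f :: "'a set \<Rightarrow> real"
  assumes "finite M"
  shows "integrable (measure_pmf (retain p M)) f"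
  using assms by (intro integrable_measure_pmf_finite finite_set_pmf_retain)

lemma expectation_retain_mono:
  fixes f g :: "'a set \<Rightarrow> real"
  assumes "finite M" "\<And>N. N \<subseteq> M \<Longrightarrow> f N \<le> g N"
  shows "measure_pmf.expectation (retain p M) f \<le> measure_pmf.expectation (retain p M) g"
  using assms set_pmf_retain[of p M]
  by (intro integral_mono_AE integrable_retain AE_pmfI) auto

lemma expectation_retain_sum:
  fixes w :: "'a \<Rightarrow> real"
  assumes "finite M" "\<And>i. i \<in> M \<Longrightarrow> p i \<in> {0..1}"
  shows "measure_pmf.expectation (retain p M) (\<lambda>N. \<Sum>i\<in>N. w i) = (\<Sum>i\<in>M. w i * p i)"
proof -
  let ?P = "Pi_pmf M False (\<lambda>i. bernoulli_pmf (p i))"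
  have fin: "finite (set_pmf ?P)"
    using assms(1) by (auto simp: set_Pi_pmf intro!: finite_PiE_dflt)
  have "measure_pmf.expectation (retain p M) (\<lambda>N. \<Sum>i\<in>N. w i) =
      measure_pmf.expectation ?P (\<lambda>b. \<Sum>i\<in>M. w i * of_bool (b i))"
    unfolding retain_def integral_map_pmf
    by (intro Bochner_Integration.integral_cong refl)
       (use assms(1) in \<open>auto simp: sum.inter_filter of_bool_def intro!: sum.cong\<close>)
  also have "\<dots> = (\<Sum>i\<in>M. w i * measure_pmf.expectation ?P (\<lambda>b. of_bool (b i)))"
    using fin by (subst Bochner_Integration.integral_sum) (auto intro!: integrable_measure_pmf_finite)
  also have "\<dots> = (\<Sum>i\<in>M. w i * p i)"
  proof (intro sum.cong refl)
    fix i assume i: "i \<in> M"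
    have "measure_pmf.expectation ?P (\<lambda>b. of_bool (b i) :: real) =
        measure_pmf.expectation (map_pmf (\<lambda>b. b i) ?P) of_bool"
      by simp
    also have "map_pmf (\<lambda>b. b i) ?P = bernoulli_pmf (p i)"
      using assms(1) i by (subst Pi_pmf_component) auto
    also have "measure_pmf.expectation (bernoulli_pmf (p i)) of_bool = p i"
      using assms(2)[OF i] by simp
    finally show "w i * measure_pmf.expectation ?P (\<lambda>b. of_bool (b i)) = w i * p i" by simp
  qed
  finally show ?thesis .
qed

lemma expectation_retain_card:
  assumes "finite M" "\<And>i. i \<in> M \<Longrightarrow> p i \<in> {0..1}"
  shows "measure_pmf.expectation (retain p M) (\<lambda>N. real (card N)) = (\<Sum>i\<in>M. p i)"
  using expectation_retain_sum[OF assms, where w = "\<lambda>_. 1"] by simp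

lemma prob_retain_card_ge:
  assumes "finite M" "\<And>i. i \<in> M \<Longrightarrow> p i \<in> {0..1}" "0 < c"
  shows "measure_pmf.prob (retain p M) {N. c \<le> real (card N)} \<le> (\<Sum>i\<in>M. p i) / c"
proof -
  have "measure_pmf.prob (retain p M) {N \<in> space (retain p M). c \<le> real (card N)} \<le>
      measure_pmf.expectation (retain p M) (\<lambda>N. real (card N)) / c"
    by (rule integral_Markov_inequality_measure[where A = "{}"])
       (use assms in \<open>auto intro: integrable_retain\<close>)
  then show ?thesis using expectation_retain_card[OF assms(1,2)] by simp
qed

text \<open>Chernoff bound from the exponential moment of \<open>- card N\<close>.\<close>

lemma prob_retain_card_le:
  assumes "finite M" "\<And>i. i \<in> M \<Longrightarrow> p i \<in> {0..1}"
  defines "\<mu> \<equiv> \<Sum>i\<in>M. p i"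
  shows "measure_pmf.prob (retain p M) {N. real (card N) \<le> \<mu> / 4} \<le> exp (- (\<mu> / 4))"
proof -
  let ?P = "Pi_pmf M False (\<lambda>i. bernoulli_pmf (p i))"
  have "measure_pmf.expectation (retain p M) (\<lambda>N. exp (- real (card N))) =
      measure_pmf.expectation ?P (\<lambda>b. \<Prod>i\<in>M. if b i then exp (- 1) else 1)"
  proof -
    have "exp (- real (card {i \<in> M. b i})) = (\<Prod>i\<in>M. if b i then exp (- 1) else (1::real))" for b
    proof -
      have "(\<Prod>i\<in>M. if b i then exp (- 1) else (1::real)) = (\<Prod>i\<in>{i \<in> M. b i}. exp (- 1))"
        using assms(1) by (rule prod.inter_filter[symmetric])
      then show ?thesis by (simp add: exp_of_nat_mult[symmetric])
    qed
    then show ?thesis unfolding retain_def integral_map_pmf by simp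
  qed
  also have "\<dots> = (\<Prod>i\<in>M. measure_pmf.expectation (bernoulli_pmf (p i)) (\<lambda>b. if b then exp (- 1) else 1))"
    using assms(1)
    by (intro expectation_prod_Pi_pmf[where f = "\<lambda>_ b. if b then exp (- 1) else 1"])
       (auto intro: integrable_measure_pmf_finite)
  \<comment> \<open>A factor equals \<open>1 - p i + p i * exp (- 1)\<close>, which is at most
    \<open>1 - p i / 2\<close>.\<close>
  also have "\<dots> \<le> (\<Prod>i\<in>M. exp (- (p i / 2)))"
  proof (intro prod_mono conjI)
    fix i assume i: "i \<in> M"
    have e: "exp (- 1) \<le> (1 / 2 :: real)"
      using exp_ge_add_one_self[of "1::real"] by (simp add: exp_minus field_simps)
    have "measure_pmf.expectation (bernoulli_pmf (p i)) (\<lambda>b. if b then exp (- 1) else 1) =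
        p i * exp (- 1) + (1 - p i)"
      using assms(2)[OF i] by simp
    also have "\<dots> \<le> p i * (1 / 2) + (1 - p i)"
      using assms(2)[OF i] e by (intro add_right_mono mult_left_mono) auto
    also have "\<dots> \<le> exp (- (p i / 2))"
      using exp_ge_add_one_self[of "- (p i / 2)"] by simp
    finally show "measure_pmf.expectation (bernoulli_pmf (p i)) (\<lambda>b. if b then exp (- 1) else 1) \<le>
      exp (- (p i / 2))" .
    show "0 \<le> measure_pmf.expectation (bernoulli_pmf (p i)) (\<lambda>b. if b then exp (- 1) else 1 :: real)"
      using assms(2)[OF i] by (auto intro!: add_nonneg_nonneg)
  qed
  also have "\<dots> = exp (- (\<mu> / 2))"
    using assms(1) by (simp add: exp_sum \<mu>_def sum_divide_distrib sum_negf[symmetric])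
  finally have mom: "measure_pmf.expectation (retain p M) (\<lambda>N. exp (- real (card N))) \<le> exp (- (\<mu> / 2))" .
  have "{N. real (card N) \<le> \<mu> / 4} = {N. exp (- (\<mu> / 4)) \<le> exp (- real (card N))}"
    by auto
  then have "measure_pmf.prob (retain p M) {N. real (card N) \<le> \<mu> / 4} =
     measure_pmf.prob (retain p M) {N \<in> space (retain p M). exp (- (\<mu> / 4)) \<le> exp (- real (card N))}"
    by simp
  \<comment> \<open>Markov's inequality at level \<open>exp (- (\<mu> / 4))\<close> gives back half
    of the exponent \<open>\<mu> / 2\<close>.\<close>
  also have "\<dots> \<le> measure_pmf.expectation (retain p M) (\<lambda>N. exp (- real (card N))) / exp (- (\<mu> / 4))"
    by (rule integral_Markov_inequality_measure[where A = "{}"])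
       (use assms(1) in \<open>auto intro: integrable_retain\<close>)
  also have "\<dots> \<le> exp (- (\<mu> / 2)) / exp (- (\<mu> / 4))"
    using mom by (intro divide_right_mono) auto
  also have "\<dots> = exp (- (\<mu> / 4))" by (simp add: exp_diff[symmetric])
  finally show ?thesis .
qed

text \<open>Stated for any set of threats because the open demands after a round have this law
  again, on the random set of survivors.\<close>

definition demands_on :: "nat set \<Rightarrow> (nat \<Rightarrow> real) \<Rightarrow> (nat \<Rightarrow> nat) pmf" where
  "demands_on M q = Pi_pmf M 0 (\<lambda>i. map_pmf Suc (geometric_pmf (1 - q i)))"

lemma demands_on_eq: "demands n q = demands_on {1..n} q"
  by (simp add: demands_def demands_on_def)

text \<open>Demands on \<open>M\<close> are at least 1 and the default outside is 0, so the active
  set can be read off the demand vector.\<close>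

lemma demands_on_support:
  assumes "finite M" "L \<in> set_pmf (demands_on M q)"
  shows "{i. 0 < L i} = M"
proof -
  have "L i \<in> range Suc" if "i \<in> M" for i
    using assms that by (auto simp: demands_on_def set_Pi_pmf PiE_dflt_def)
  moreover have "L i = 0" if "i \<notin> M" for i
    using assms that by (auto simp: demands_on_def set_Pi_pmf PiE_dflt_def)
  ultimately show ?thesis by fastforce
qed

text \<open>Memorylessness, with the truncated subtraction recording only the demand still open.\<close>

lemma geometric_memoryless:
  assumes "0 < q" "q < 1"
  shows "map_pmf (\<lambda>l. l - x) (map_pmf Suc (geometric_pmf (1 - q))) =
    bernoulli_pmf (q ^ x) \<bind>
      (\<lambda>b. if b then map_pmf Suc (geometric_pmf (1 - q)) else return_pmf 0)" (is "?l = ?r")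
proof (rule pmf_eqI)
  fix k
  let ?g = "geometric_pmf (1 - q)"
  have qx: "0 \<le> q ^ x" "q ^ x \<le> 1" using assms by (auto simp: power_le_one)
  have r: "pmf ?r k = q ^ x * pmf (map_pmf Suc ?g) k + (1 - q ^ x) * pmf (return_pmf 0) k"
    using qx by (simp add: pmf_bind)
  have suc: "pmf (map_pmf Suc ?g) (Suc j) = q ^ j * (1 - q)" for j
    using assms by (subst pmf_map_inj') auto
  have suc0: "pmf (map_pmf Suc ?g) 0 = 0"
    by (auto simp: pmf_eq_0_set_pmf)
  show "pmf ?l k = pmf ?r k"
  proof (cases k)
    case 0
    have "pmf ?l 0 = measure_pmf.prob ?g ((\<lambda>l. Suc l - x) -` {0})"
      by (simp add: pmf.map_comp pmf_map comp_def)
    also have "(\<lambda>l. Suc l - x) -` {0} = {..<x}" by auto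
    also have "measure_pmf.prob ?g {..<x} = (\<Sum>j<x. q ^ j * (1 - q))"
      using assms by (simp add: measure_measure_pmf_finite)
    also have "\<dots> = 1 - q ^ x"
      using assms by (simp add: sum_distrib_right [symmetric] sum_gp_strict)
    finally show ?thesis using 0 r suc0 by simp
  next
    case (Suc j)
    have "pmf ?l k = measure_pmf.prob ?g ((\<lambda>l. Suc l - x) -` {k})"
      by (simp add: pmf.map_comp pmf_map comp_def)
    also have "(\<lambda>l. Suc l - x) -` {k} = {j + x}" using Suc by auto
    also have "measure_pmf.prob ?g {j + x} = q ^ x * (q ^ j * (1 - q))"
      using assms by (simp add: measure_pmf_single power_add)
    finally show ?thesis using Suc r suc by simp
  qed
qed

text \<open>Memorylessness in every coordinate: one coin per threat decides survival, and given the
  survivors their open demands are fresh.\<close>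

lemma demands_on_step:
  assumes "finite M" "\<And>i. i \<in> M \<Longrightarrow> 0 < q i \<and> q i < 1"
  shows "map_pmf (\<lambda>L i. L i - x i) (demands_on M q) =
    retain (\<lambda>i. q i ^ x i) M \<bind> (\<lambda>N. demands_on N q)"
proof -
  let ?G = "\<lambda>i. map_pmf Suc (geometric_pmf (1 - q i))"
  have "map_pmf (\<lambda>L i. L i - x i) (demands_on M q) = Pi_pmf M 0 (\<lambda>i. map_pmf (\<lambda>l. l - x i) (?G i))"
  proof -
    have "Pi_pmf M 0 (\<lambda>i. map_pmf (\<lambda>l. l - x i) (?G i)) =
        Pi_pmf M 0 (\<lambda>i. ?G i \<bind> (\<lambda>l. return_pmf (l - x i)))"
      by (simp add: map_pmf_def)
    also have "\<dots> = Pi_pmf M 0 ?G \<bind> (\<lambda>L. Pi_pmf M 0 (\<lambda>i. return_pmf (L i - x i)))"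
      using assms(1) by (rule Pi_pmf_bind)
    \<comment> \<open>Outside \<open>M\<close> the demand is 0 and truncated subtraction keeps it 0,
      in agreement with the default value of the product.\<close>
    also have "\<dots> = Pi_pmf M 0 ?G \<bind> (\<lambda>L. return_pmf (\<lambda>i. L i - x i))"
    proof (intro bind_pmf_cong refl)
      fix L assume "L \<in> set_pmf (Pi_pmf M 0 ?G)"
      then have "\<And>i. i \<notin> M \<Longrightarrow> L i = 0" using assms(1) by (auto simp: set_Pi_pmf PiE_dflt_def)
      then show "Pi_pmf M 0 (\<lambda>i. return_pmf (L i - x i)) = return_pmf (\<lambda>i. L i - x i)"
        using assms(1) by (subst Pi_pmf_return_pmf) (auto intro!: arg_cong[of _ _ return_pmf])
    qed
    finally show ?thesis by (simp add: demands_on_def map_pmf_def)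
  qed
  also have "\<dots> = Pi_pmf M 0 (\<lambda>i. bernoulli_pmf (q i ^ x i) \<bind>
      (\<lambda>b. if b then ?G i else return_pmf 0))"
    using assms(2) by (intro Pi_pmf_cong refl geometric_memoryless) auto
  also have "\<dots> = Pi_pmf M False (\<lambda>i. bernoulli_pmf (q i ^ x i)) \<bind>
      (\<lambda>b. Pi_pmf M 0 (\<lambda>i. if b i then ?G i else return_pmf 0))"
    using assms(1) by (rule Pi_pmf_bind)
  \<comment> \<open>A threat whose coin fails has constant demand 0, the default, so the product
    shrinks to the survivors.\<close>
  also have "\<dots> = Pi_pmf M False (\<lambda>i. bernoulli_pmf (q i ^ x i)) \<bind>
      (\<lambda>b. Pi_pmf {i \<in> M. b i} 0 ?G)"
    using assms(1) by (subst Pi_pmf_if_set) auto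
  also have "\<dots> = retain (\<lambda>i. q i ^ x i) M \<bind> (\<lambda>N. demands_on N q)"
    by (simp add: retain_def demands_on_def bind_map_pmf)
  finally show ?thesis .
qed

text \<open>Open demands after \<open>t\<close> rounds. The active set is taken as the support of
  the current vector, so a round is a map of that vector alone.\<close>

fun residual :: "policy \<Rightarrow> (nat \<Rightarrow> nat) \<Rightarrow> nat \<Rightarrow> nat \<Rightarrow> nat" where
  "residual \<pi> L 0 = L"
| "residual \<pi> L (Suc t) =
    (\<lambda>i. residual \<pi> L t i - \<pi> (Suc t) {j. 0 < residual \<pi> L t j} i)"

text \<open>\<open>active_law n q \<pi> t\<close> is the law of the active set at the start of round \<open>t + 1\<close>.\<close>

fun active_law :: "nat \<Rightarrow> (nat \<Rightarrow> real) \<Rightarrow> policy \<Rightarrow> nat \<Rightarrow> nat set pmf" where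
  "active_law n q \<pi> 0 = return_pmf {1..n}"
| "active_law n q \<pi> (Suc t) =
    active_law n q \<pi> t \<bind> (\<lambda>M. retain (\<lambda>i. q i ^ \<pi> (Suc t) M i) M)"

lemma set_pmf_active_law: "set_pmf (active_law n q \<pi> t) \<subseteq> Pow {1..n}"
proof (induction t)
  case (Suc t)
  then show ?case using set_pmf_retain by (fastforce simp: set_bind_pmf)
qed simp

text \<open>The induction carries the law of the whole vector: given the active set, the open
  demands are fresh. One more round is then \<open>demands_on_step\<close>.\<close>

lemma residual_law:
  assumes "\<And>i. i \<in> {1..n} \<Longrightarrow> 0 < q i \<and> q i < 1"
  shows "map_pmf (\<lambda>L. residual \<pi> L t) (demands n q) =
    active_law n q \<pi> t \<bind> (\<lambda>M. demands_on M q)"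
proof (induction t)
  case 0
  show ?case by (simp add: demands_on_eq bind_return_pmf)
next
  case (Suc t)
  let ?f = "\<lambda>R i. R i - \<pi> (Suc t) {j. 0 < R j} i"
  have "map_pmf (\<lambda>L. residual \<pi> L (Suc t)) (demands n q) =
      map_pmf ?f (map_pmf (\<lambda>L. residual \<pi> L t) (demands n q))"
    by (simp add: pmf.map_comp comp_def)
  also have "\<dots> = active_law n q \<pi> t \<bind> (\<lambda>M. map_pmf ?f (demands_on M q))"
    by (simp add: Suc map_bind_pmf)
  also have "\<dots> = active_law n q \<pi> t \<bind>
      (\<lambda>M. retain (\<lambda>i. q i ^ \<pi> (Suc t) M i) M \<bind> (\<lambda>N. demands_on N q))"
  proof (intro bind_pmf_cong refl)
    fix M assume "M \<in> set_pmf (active_law n q \<pi> t)"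
    then have M: "M \<subseteq> {1..n}" using set_pmf_active_law by blast
    then have fin: "finite M" by (rule finite_subset) simp
    \<comment> \<open>The policy sees only the support of the vector, which is \<open>M\<close>
      almost surely.\<close>
    have "map_pmf ?f (demands_on M q) = map_pmf (\<lambda>R i. R i - \<pi> (Suc t) M i) (demands_on M q)"
      using demands_on_support[OF fin] by (intro map_pmf_cong refl) simp
    also have "\<dots> = retain (\<lambda>i. q i ^ \<pi> (Suc t) M i) M \<bind> (\<lambda>N. demands_on N q)"
      using assms M fin by (intro demands_on_step) auto
    finally show "map_pmf ?f (demands_on M q) =
      retain (\<lambda>i. q i ^ \<pi> (Suc t) M i) M \<bind> (\<lambda>N. demands_on N q)" .
  qed
  also have "\<dots> = active_law n q \<pi> (Suc t) \<bind> (\<lambda>M. demands_on M q)"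
    by (simp add: bind_assoc_pmf)
  finally show ?case .
qed

lemma active_law_eq:
  assumes "\<And>i. i \<in> {1..n} \<Longrightarrow> 0 < q i \<and> q i < 1"
  shows "map_pmf (\<lambda>L. {i. 0 < residual \<pi> L t i}) (demands n q) = active_law n q \<pi> t"
proof -
  have "map_pmf (\<lambda>L. {i. 0 < residual \<pi> L t i}) (demands n q) =
      map_pmf (\<lambda>R. {i. 0 < R i}) (map_pmf (\<lambda>L. residual \<pi> L t) (demands n q))"
    by (simp add: pmf.map_comp comp_def)
  also have "\<dots> = active_law n q \<pi> t \<bind> (\<lambda>M. map_pmf (\<lambda>R. {i. 0 < R i}) (demands_on M q))"
    by (subst residual_law) (use assms in \<open>auto simp: map_bind_pmf\<close>)
  also have "\<dots> = active_law n q \<pi> t \<bind> (\<lambda>M. return_pmf M)"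
  proof (intro bind_pmf_cong refl)
    fix M assume "M \<in> set_pmf (active_law n q \<pi> t)"
    then have "M \<subseteq> {1..n}" using set_pmf_active_law by blast
    then have fin: "finite M" by (rule finite_subset) simp
    have "map_pmf (\<lambda>R. {i. 0 < R i}) (demands_on M q) = map_pmf (\<lambda>R. M) (demands_on M q)"
      using demands_on_support[OF fin] by (intro map_pmf_cong refl) simp
    then show "map_pmf (\<lambda>R. {i. 0 < R i}) (demands_on M q) = return_pmf M" by simp
  qed
  finally show ?thesis by (simp add: bind_return_pmf')
qed

section \<open>The defusing time along one demand vector\<close>

context
  fixes n :: nat and L :: "nat \<Rightarrow> nat" and \<pi> :: policy
  assumes L: "{i. 0 < L i} = {1..n}"
begin

text \<open>Both claims share one induction: the next allocation depends on the active set, and the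
  next active set on the open demands.\<close>

lemma residual_eq_active:
  "residual \<pi> L t = (\<lambda>i. L i - (\<Sum>l\<in>{1..t}. allocation n \<pi> L l i)) \<and>
   active n \<pi> L (Suc t) = {i. 0 < residual \<pi> L t i}"
proof (induction t)
  case 0
  have "active n \<pi> L (Suc 0) = {1..n}" by (subst active.simps) simp
  then show ?case using L by simp
next
  case (Suc t)
  have res: "residual \<pi> L (Suc t) = (\<lambda>i. L i - (\<Sum>l\<in>{1..Suc t}. allocation n \<pi> L l i))"
  proof
    fix i
    have "residual \<pi> L (Suc t) i = residual \<pi> L t i - allocation n \<pi> L (Suc t) i"
      using Suc by (simp only: residual.simps allocation_def)
    also have "residual \<pi> L t i = L i - (\<Sum>l\<in>{1..t}. allocation n \<pi> L l i)"
      using Suc by metis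
    finally show "residual \<pi> L (Suc t) i = L i - (\<Sum>l\<in>{1..Suc t}. allocation n \<pi> L l i)"
      by simp
  qed
  have "active n \<pi> L (Suc (Suc t)) =
      {i \<in> active n \<pi> L (Suc t). (\<Sum>l\<in>{1..Suc t}. allocation n \<pi> L l i) < L i}"
    by (subst active.simps) (simp add: allocation_def)
  also have "\<dots> = {i. 0 < residual \<pi> L (Suc t) i}"
  proof -
    \<comment> \<open>Open demands never increase, so whatever is open now was active before and the
      recursive filter in \<open>active\<close> removes nothing more.\<close>
    have "residual \<pi> L (Suc t) i \<le> residual \<pi> L t i" for i by simp
    moreover have "(\<Sum>l\<in>{1..Suc t}. allocation n \<pi> L l i) < L i \<longleftrightarrow> 0 < residual \<pi> L (Suc t) i" for i
      unfolding res by simp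
    ultimately show ?thesis using Suc[THEN conjunct2]
      by (auto simp del: residual.simps intro: less_le_trans)
  qed
  finally show ?case using res by blast
qed

lemma done_iff:
  "(\<forall>i\<in>{1..n}. L i \<le> (\<Sum>l\<in>{1..t}. allocation n \<pi> L l i)) \<longleftrightarrow> {i. 0 < residual \<pi> L t i} = {}"
proof -
  have "L i = 0" if "i \<notin> {1..n}" for i using that unfolding L[symmetric] by simp
  moreover have "residual \<pi> L t i = L i - (\<Sum>l\<in>{1..t}. allocation n \<pi> L l i)" for i
    using residual_eq_active[of t] by metis
  ultimately show ?thesis by (metis (mono_tags, lifting) Collect_empty_eq diff_is_0_eq le0 neq0_conv)
qed

lemma support_residual: "{i. 0 < residual \<pi> L t i} \<subseteq> {1..n}"
proof -
  have "residual \<pi> L t i \<le> L i" for i by (induction t) (auto simp: le_diff_conv intro: trans_le_add1)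
  then have "{i. 0 < residual \<pi> L t i} \<subseteq> {i. 0 < L i}" by (auto intro: less_le_trans)
  then show ?thesis using L by simp
qed

lemma residual_sum_less:
  assumes "\<pi> \<in> policies n C" "1 \<le> C" "{i. 0 < residual \<pi> L t i} \<noteq> {}"
  shows "(\<Sum>i\<in>{1..n}. residual \<pi> L (Suc t) i) < (\<Sum>i\<in>{1..n}. residual \<pi> L t i)"
proof -
  let ?M = "{i. 0 < residual \<pi> L t i}"
  have "(\<Sum>i\<in>?M. \<pi> (Suc t) ?M i) = C"
    using assms(1,3) support_residual[of t] unfolding policies_def by simp
  then have "(\<Sum>i\<in>?M. \<pi> (Suc t) ?M i) \<noteq> 0" using assms(2) by simp
  then obtain i where "i \<in> ?M" "\<pi> (Suc t) ?M i \<noteq> 0" by (meson sum.neutral)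
  then have "residual \<pi> L (Suc t) i < residual \<pi> L t i" by simp
  moreover have "i \<in> {1..n}" using \<open>i \<in> ?M\<close> support_residual[of t] by blast
  ultimately show ?thesis by (intro sum_strict_mono_ex1) auto
qed

text \<open>The total open demand is a natural number that falls in every active round. So the
  minimum defining the defusing time is attained.\<close>

lemma residual_eventually_empty:
  assumes "\<pi> \<in> policies n C" "1 \<le> C"
  shows "\<exists>t. {i. 0 < residual \<pi> L t i} = {}"
proof (rule ccontr)
  assume *: "\<not> ?thesis"
  have "(\<Sum>i\<in>{1..n}. residual \<pi> L t i) + t \<le> (\<Sum>i\<in>{1..n}. L i)" for t
  proof (induction t)
    case (Suc t)
    have "{i. 0 < residual \<pi> L t i} \<noteq> {}" using * by blast
    from residual_sum_less[OF assms this] Suc show ?case by linarith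
  qed simp
  from this[of "Suc (\<Sum>i\<in>{1..n}. L i)"] show False by simp
qed

text \<open>Emptiness of the active set persists, so the tail events of the defusing time are events
  of the Markov chain.\<close>

lemma less_defusing_time_iff:
  assumes "\<pi> \<in> policies n C" "1 \<le> C"
  shows "t < defusing_time n \<pi> L \<longleftrightarrow> {i. 0 < residual \<pi> L t i} \<noteq> {}"
proof -
  have T: "defusing_time n \<pi> L = (LEAST t. {i. 0 < residual \<pi> L t i} = {})"
    unfolding defusing_time_def done_iff ..
  have antimono: "residual \<pi> L (s + d) i \<le> residual \<pi> L s i" for s d i
    by (induction d) (auto simp: le_diff_conv intro: trans_le_add1)
  have "{i. 0 < residual \<pi> L (defusing_time n \<pi> L) i} = {}"
    unfolding T by (rule LeastI_ex[OF residual_eventually_empty[OF assms]])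
  then have "residual \<pi> L (defusing_time n \<pi> L) i = 0" for i by simp
  then have "residual \<pi> L t i = 0" if "defusing_time n \<pi> L \<le> t" for i
    using antimono[of "defusing_time n \<pi> L" "t - defusing_time n \<pi> L" i] that by simp
  then have "{i. 0 < residual \<pi> L t i} = {}" if "defusing_time n \<pi> L \<le> t"
    using that by simp
  moreover have "defusing_time n \<pi> L \<le> t" if "{i. 0 < residual \<pi> L t i} = {}"
    using that unfolding T by (rule Least_le)
  ultimately show ?thesis by (meson not_le)
qed

end

subsection \<open>Drift bounds for the expected defusing time\<close>

definition active_prob :: "nat \<Rightarrow> (nat \<Rightarrow> real) \<Rightarrow> policy \<Rightarrow> nat \<Rightarrow> real" where
  "active_prob n q \<pi> t = measure_pmf.prob (active_law n q \<pi> t) {M. M \<noteq> {}}"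

text \<open>The state space is finite; written as finite sums, expectations are linear without
  integrability conditions.\<close>

lemma expectation_active_law:
  fixes f :: "nat set \<Rightarrow> real"
  shows "measure_pmf.expectation (active_law n q \<pi> t) f =
    (\<Sum>M\<in>Pow {1..n}. pmf (active_law n q \<pi> t) M * f M)"
  using set_pmf_active_law[of n q \<pi> t] by (subst integral_measure_pmf[of "Pow {1..n}"]) auto

lemma expectation_active_law_Suc:
  fixes f :: "nat set \<Rightarrow> real"
  shows "measure_pmf.expectation (active_law n q \<pi> (Suc t)) f =
    measure_pmf.expectation (active_law n q \<pi> t)
      (\<lambda>M. measure_pmf.expectation (retain (\<lambda>i. q i ^ \<pi> (Suc t) M i) M) f)"
  unfolding expectation_active_law[of n q \<pi> t] active_law.simps
  using set_pmf_active_law[of n q \<pi> t]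
  by (subst pmf_expectation_bind[of "Pow {1..n}"])
     (auto intro!: finite_set_pmf_retain intro: finite_subset)

lemma expectation_active_law_mono:
  fixes f g :: "nat set \<Rightarrow> real"
  assumes "\<And>M. M \<subseteq> {1..n} \<Longrightarrow> f M \<le> g M"
  shows "measure_pmf.expectation (active_law n q \<pi> t) f \<le> measure_pmf.expectation (active_law n q \<pi> t) g"
  unfolding expectation_active_law by (intro sum_mono mult_left_mono assms) auto

lemma expectation_active_law_nonempty:
  "measure_pmf.expectation (active_law n q \<pi> t) (\<lambda>M. of_bool (M \<noteq> {})) = active_prob n q \<pi> t"
proof -
  have "(\<lambda>M :: nat set. of_bool (M \<noteq> {}) :: real) = indicator {M. M \<noteq> {}}"
    by (auto simp: indicator_def)
  then show ?thesis by (simp add: active_prob_def)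
qed

lemma active_prob_nonneg: "0 \<le> active_prob n q \<pi> t"
  by (simp add: active_prob_def)

lemma retain_empty: "retain p {} = return_pmf {}"
  by (simp add: retain_def)

text \<open>The drift telescopes: tail probabilities accumulated so far plus the expected remaining
  potential stay below the initial potential. At the empty set the chain rests, so only active
  rounds are charged.\<close>

lemma sum_active_prob_le:
  fixes \<Phi> :: "nat set \<Rightarrow> real"
  assumes "\<And>M. M \<subseteq> {1..n} \<Longrightarrow> 0 \<le> \<Phi> M"
    and "\<And>t M. M \<subseteq> {1..n} \<Longrightarrow> M \<noteq> {} \<Longrightarrow>
      measure_pmf.expectation (retain (\<lambda>i. q i ^ \<pi> (Suc t) M i) M) \<Phi> \<le> \<Phi> M - 1"
  shows "(\<Sum>t<k. active_prob n q \<pi> t) \<le> \<Phi> {1..n}"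
proof -
  have "(\<Sum>t<k. active_prob n q \<pi> t) + measure_pmf.expectation (active_law n q \<pi> k) \<Phi> \<le> \<Phi> {1..n}"
  proof (induction k)
    case (Suc k)
    have "measure_pmf.expectation (active_law n q \<pi> (Suc k)) \<Phi> \<le>
        measure_pmf.expectation (active_law n q \<pi> k) (\<lambda>M. \<Phi> M - of_bool (M \<noteq> {}))"
      unfolding expectation_active_law_Suc
      using assms(2) by (intro expectation_active_law_mono) (auto simp: retain_empty)
    also have "\<dots> = measure_pmf.expectation (active_law n q \<pi> k) \<Phi> - active_prob n q \<pi> k"
      unfolding expectation_active_law_nonempty[symmetric] expectation_active_law
      by (simp add: right_diff_distrib sum_subtractf)
    finally show ?case using Suc by simp
  qed simp
  moreover have "0 \<le> measure_pmf.expectation (active_law n q \<pi> k) \<Phi>"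
    unfolding expectation_active_law using assms(1) by (intro sum_nonneg mult_nonneg_nonneg) auto
  ultimately show ?thesis by linarith
qed

text \<open>The same telescoping in the other direction. The remaining potential is kept;
  \<open>expected_defusing_time_ge\<close> bounds it by a null sequence.\<close>

lemma sum_active_prob_ge:
  fixes U :: "nat set \<Rightarrow> real"
  assumes "\<And>t M. M \<subseteq> {1..n} \<Longrightarrow> M \<noteq> {} \<Longrightarrow>
      measure_pmf.expectation (retain (\<lambda>i. q i ^ \<pi> (Suc t) M i) M) U \<ge> U M - 1"
  shows "U {1..n} \<le> (\<Sum>t<k. active_prob n q \<pi> t) + measure_pmf.expectation (active_law n q \<pi> k) U"
proof (induction k)
  case (Suc k)
  have "measure_pmf.expectation (active_law n q \<pi> k) U - active_prob n q \<pi> k =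
      measure_pmf.expectation (active_law n q \<pi> k) (\<lambda>M. U M - of_bool (M \<noteq> {}))"
    unfolding expectation_active_law_nonempty[symmetric] expectation_active_law
    by (simp add: right_diff_distrib sum_subtractf)
  also have "\<dots> \<le> measure_pmf.expectation (active_law n q \<pi> (Suc k)) U"
    unfolding expectation_active_law_Suc
    using assms by (intro expectation_active_law_mono) (auto simp: retain_empty)
  finally show ?case using Suc by simp
qed simp

section \<open>The expectation as a sum of tail probabilities\<close>

context
  fixes n C :: nat and q :: "nat \<Rightarrow> real" and \<pi> :: policy
  assumes q: "\<And>i. i \<in> {1..n} \<Longrightarrow> 0 < q i \<and> q i < 1"
    and \<pi>: "\<pi> \<in> policies n C" and C: "1 \<le> C"
begin

lemma prob_less_defusing_time:
  "measure_pmf.prob (demands n q) {L. t < defusing_time n \<pi> L} = active_prob n q \<pi> t"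
proof -
  have "active_prob n q \<pi> t = measure_pmf.prob (demands n q) {L. {i. 0 < residual \<pi> L t i} \<noteq> {}}"
    unfolding active_prob_def by (subst active_law_eq[OF q, symmetric]) (simp_all add: vimage_def)
  moreover have "t < defusing_time n \<pi> L \<longleftrightarrow> {i. 0 < residual \<pi> L t i} \<noteq> {}"
    if "L \<in> set_pmf (demands n q)" for L
    using demands_on_support[of "{1..n}" L q] that \<pi> C
    by (intro less_defusing_time_iff) (auto simp: demands_on_eq)
  \<comment> \<open>The events are compared only on the support of the law, where the positive
    demands are exactly those in \<open>{1..n}\<close>.\<close>
  then have "{L. t < defusing_time n \<pi> L} \<inter> set_pmf (demands n q) =
      {L. {i. 0 < residual \<pi> L t i} \<noteq> {}} \<inter> set_pmf (demands n q)" by blast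
  then have "measure_pmf.prob (demands n q) {L. t < defusing_time n \<pi> L} =
      measure_pmf.prob (demands n q) {L. {i. 0 < residual \<pi> L t i} \<noteq> {}}"
    by (metis measure_Int_set_pmf)
  ultimately show ?thesis by simp
qed

text \<open>Tail-sum formula; the form \<open>has_bochner_integral\<close> delivers integrability
  together with the value.\<close>

lemma has_integral_defusing_time:
  assumes "summable (active_prob n q \<pi>)"
  shows "has_bochner_integral (measure_pmf (demands n q)) (\<lambda>L. real (defusing_time n \<pi> L))
    (\<Sum>t. active_prob n q \<pi> t)"
proof (rule has_bochner_integral_nn_integral)
  have "(\<integral>\<^sup>+ L. ennreal (real (defusing_time n \<pi> L)) \<partial>demands n q) =
      (\<integral>\<^sup>+ L. of_nat (defusing_time n \<pi> L) \<partial>demands n q)"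
    by (simp add: ennreal_of_nat_eq_real_of_nat)
  also have "\<dots> = (\<Sum>t. emeasure (demands n q) {L \<in> space (demands n q). t < defusing_time n \<pi> L})"
    by (rule nn_integral_nat_function) simp
  also have "\<dots> = (\<Sum>t. ennreal (active_prob n q \<pi> t))"
    by (simp add: measure_pmf.emeasure_eq_measure prob_less_defusing_time)
  also have "\<dots> = ennreal (\<Sum>t. active_prob n q \<pi> t)"
    using active_prob_nonneg assms by (intro suminf_ennreal2) auto
  finally show "(\<integral>\<^sup>+ L. ennreal (real (defusing_time n \<pi> L)) \<partial>demands n q) =
    ennreal (\<Sum>t. active_prob n q \<pi> t)" .
qed (auto intro!: suminf_nonneg assms active_prob_nonneg)

lemma expected_defusing_time_le:
  fixes \<Phi> :: "nat set \<Rightarrow> real"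
  assumes "\<And>M. M \<subseteq> {1..n} \<Longrightarrow> 0 \<le> \<Phi> M"
    and "\<And>t M. M \<subseteq> {1..n} \<Longrightarrow> M \<noteq> {} \<Longrightarrow>
      measure_pmf.expectation (retain (\<lambda>i. q i ^ \<pi> (Suc t) M i) M) \<Phi> \<le> \<Phi> M - 1"
  shows "summable (active_prob n q \<pi>)" "expected_defusing_time n q \<pi> \<le> \<Phi> {1..n}"
proof -
  note le = sum_active_prob_le[where \<Phi> = \<Phi> and n = n and q = q and \<pi> = \<pi>, OF assms]
  show s: "summable (active_prob n q \<pi>)"
    using active_prob_nonneg le by (rule summableI_nonneg_bounded)
  have "expected_defusing_time n q \<pi> = (\<Sum>t. active_prob n q \<pi> t)"
    using has_integral_defusing_time[OF s]
    unfolding expected_defusing_time_def by (rule has_bochner_integral_integral_eq)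
  also have "\<dots> \<le> \<Phi> {1..n}" using s le by (rule suminf_le_const)
  finally show "expected_defusing_time n q \<pi> \<le> \<Phi> {1..n}" .
qed

text \<open>On the finite state space \<open>U\<close> is bounded by some \<open>B\<close>, and
  \<open>U {} = 0\<close>, so the leftover expectation is at most \<open>B\<close> times a tail
  probability, which tends to 0 by summability.\<close>

lemma expected_defusing_time_ge:
  fixes U :: "nat set \<Rightarrow> real"
  assumes s: "summable (active_prob n q \<pi>)" and "U {} = 0"
    and "\<And>t M. M \<subseteq> {1..n} \<Longrightarrow> M \<noteq> {} \<Longrightarrow>
      measure_pmf.expectation (retain (\<lambda>i. q i ^ \<pi> (Suc t) M i) M) U \<ge> U M - 1"
  shows "U {1..n} \<le> expected_defusing_time n q \<pi>"
proof -
  define B where "B = (\<Sum>M\<in>Pow {1..n}. \<bar>U M\<bar>)"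
  have "measure_pmf.expectation (active_law n q \<pi> k) U \<le> B * active_prob n q \<pi> k" for k
  proof -
    have "measure_pmf.expectation (active_law n q \<pi> k) U \<le>
        measure_pmf.expectation (active_law n q \<pi> k) (\<lambda>M. B * of_bool (M \<noteq> {}))"
    proof (rule expectation_active_law_mono)
      fix M :: "nat set" assume "M \<subseteq> {1..n}"
      then have "\<bar>U M\<bar> \<le> B" unfolding B_def by (intro member_le_sum) auto
      then show "U M \<le> B * of_bool (M \<noteq> {})" using assms(2) by auto
    qed
    then show ?thesis by (simp add: expectation_active_law_nonempty)
  qed
  then have le: "U {1..n} \<le> (\<Sum>t<k. active_prob n q \<pi> t) + B * active_prob n q \<pi> k" for k
    using sum_active_prob_ge[where U = U and n = n and q = q and \<pi> = \<pi> and k = k, OF assms(3)] by (meson add_left_mono order_trans)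
  have "(\<lambda>k. (\<Sum>t<k. active_prob n q \<pi> t) + B * active_prob n q \<pi> k) \<longlonglongrightarrow>
      (\<Sum>t. active_prob n q \<pi> t) + B * 0"
    using s by (intro tendsto_intros summable_LIMSEQ summable_LIMSEQ_zero)
  then have "U {1..n} \<le> (\<Sum>t. active_prob n q \<pi> t) + B * 0"
    using le by (intro LIMSEQ_le_const[of _ _ "U {1..n}"]) auto
  also have "(\<Sum>t. active_prob n q \<pi> t) + B * 0 = expected_defusing_time n q \<pi>"
    using has_integral_defusing_time[OF s] unfolding expected_defusing_time_def
    by (simp add: has_bochner_integral_integral_eq)
  finally show ?thesis .
qed

end

subsection \<open>One round of a fair allocation\<close>

context
  fixes n C :: nat and M :: "nat set" and x :: "nat \<Rightarrow> nat"
  assumes fair: "fair_allocation n C M x" and fin: "finite M"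
begin

lemma fair_allocation_sum: "(\<Sum>i\<in>M. x i) = C"
  using fair by (simp add: fair_allocation_def)

lemma fair_allocation_le_Suc:
  assumes "i \<in> M" "j \<in> M"
  shows "x i \<le> x j + 1"
proof -
  have "\<bar>int (x i) - int (x j)\<bar> \<in> {0, 1}" using fair assms by (simp add: fair_allocation_def)
  then show ?thesis by auto
qed

lemma fair_allocation_ge:
  assumes i: "i \<in> M"
  shows "C div card M \<le> x i"
proof (rule ccontr)
  assume less: "\<not> ?thesis"
  then have "x j \<le> C div card M" if "j \<in> M" for j
    using fair_allocation_le_Suc[OF that i] by simp
  then have "(\<Sum>j\<in>M. x j) < (\<Sum>j\<in>M. C div card M)"
    using i fin less by (intro sum_strict_mono_ex1 ballI bexI[of _ i]) auto
  then show False using fair_allocation_sum times_div_less_eq_dividend[of "card M" C] by simp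
qed

text \<open>Every active threat gets at least \<open>x i - 1\<close>.\<close>

lemma fair_allocation_le:
  assumes i: "i \<in> M"
  shows "(x i - 1) * card M \<le> C"
proof -
  have "(\<Sum>j\<in>M. x i - 1) \<le> (\<Sum>j\<in>M. x j)"
    using fair_allocation_le_Suc[OF i] by (intro sum_mono) (simp add: le_diff_conv)
  then show ?thesis using fair_allocation_sum by (simp add: mult.commute)
qed

text \<open>Two effectors on one threat would leave at least one on each other, more than
  \<open>C\<close> in total.\<close>

lemma fair_allocation_le_1:
  assumes i: "i \<in> M" and "C \<le> card M"
  shows "x i \<le> 1"
proof (rule ccontr)
  assume less: "\<not> ?thesis"
  then have "1 \<le> x j" if "j \<in> M" for j
    using fair_allocation_le_Suc[OF i that] by simp
  then have "(\<Sum>j\<in>M. 1) < (\<Sum>j\<in>M. x j)"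
    using i fin less by (intro sum_strict_mono_ex1 ballI bexI[of _ i]) auto
  then show False using fair_allocation_sum assms(2) by simp
qed

end

section \<open>Drift of the workload\<close>

definition workload :: "nat \<Rightarrow> (nat \<Rightarrow> real) \<Rightarrow> nat set \<Rightarrow> real" where
  "workload C q M = (\<Sum>i\<in>M. 1 / (1 - q i) / real C)"

lemma expectation_workload:
  assumes "finite M" "\<And>i. i \<in> M \<Longrightarrow> 0 < q i \<and> q i < 1"
  shows "measure_pmf.expectation (retain (\<lambda>i. q i ^ x i) M) (workload C q) =
    workload C q M - (\<Sum>i\<in>M. (1 - q i ^ x i) / (1 - q i) / real C)"
proof -
  have "measure_pmf.expectation (retain (\<lambda>i. q i ^ x i) M) (workload C q) =
      (\<Sum>i\<in>M. 1 / (1 - q i) / real C * q i ^ x i)"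
    unfolding workload_def using assms
    by (intro expectation_retain_sum) (auto simp: power_le_one less_imp_le)
  also have "\<dots> = (\<Sum>i\<in>M. 1 / (1 - q i) / real C - (1 - q i ^ x i) / (1 - q i) / real C)"
    by (intro sum.cong refl) (simp add: diff_divide_distrib)
  finally show ?thesis by (simp add: workload_def sum_subtractf)
qed

text \<open>Of \<open>x i\<close> effectors on a threat, \<open>(1 - q i ^ x i) / (1 - q i)\<close>
  are used in expectation, at most \<open>x i\<close> by Bernoulli's inequality.\<close>

lemma workload_drift_ge:
  assumes "finite M" "\<And>i. i \<in> M \<Longrightarrow> 0 < q i \<and> q i < 1" "(\<Sum>i\<in>M. x i) = C"
  shows "measure_pmf.expectation (retain (\<lambda>i. q i ^ x i) M) (workload C q) \<ge> workload C q M - 1"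
proof -
  have "(\<Sum>i\<in>M. (1 - q i ^ x i) / (1 - q i) / real C) \<le> (\<Sum>i\<in>M. real (x i) / real C)"
  proof (intro sum_mono divide_right_mono)
    fix i assume "i \<in> M"
    then have qi: "0 < q i" "q i < 1" using assms(2) by auto
    have "1 + real (x i) * (q i - 1) \<le> (1 + (q i - 1)) ^ x i"
      using qi by (intro Bernoulli_inequality) simp
    then show "(1 - q i ^ x i) / (1 - q i) \<le> real (x i)"
      using qi by (simp add: field_simps)
  qed simp
  also have "\<dots> \<le> 1"
    using assms(3) by (simp add: sum_divide_distrib[symmetric] flip: of_nat_sum)
  finally show ?thesis by (simp add: expectation_workload[OF assms(1,2)])
qed

lemma workload_drift_le:
  assumes "finite M" "\<And>i. i \<in> M \<Longrightarrow> 0 < q i \<and> q i < 1"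
  shows "measure_pmf.expectation (retain (\<lambda>i. q i ^ x i) M) (workload C q) \<le> workload C q M"
proof -
  have "0 \<le> (\<Sum>i\<in>M. (1 - q i ^ x i) / (1 - q i) / real C)"
    using assms(2) by (intro sum_nonneg divide_nonneg_nonneg) (auto simp: power_le_one less_imp_le)
  then show ?thesis by (simp add: expectation_workload[OF assms])
qed

lemma workload_drift_eq:
  assumes "finite M" "\<And>i. i \<in> M \<Longrightarrow> 0 < q i \<and> q i < 1" "(\<Sum>i\<in>M. x i) = C" "1 \<le> C"
    and "\<And>i. i \<in> M \<Longrightarrow> x i \<le> 1"
  shows "measure_pmf.expectation (retain (\<lambda>i. q i ^ x i) M) (workload C q) = workload C q M - 1"
proof -
  have "(1 - q i ^ x i) / (1 - q i) = real (x i)" if "i \<in> M" for i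
  proof -
    have "x i = 0 \<or> x i = 1" using assms(5)[OF that] by linarith
    then show ?thesis using assms(2)[OF that] by auto
  qed
  then have "(\<Sum>i\<in>M. (1 - q i ^ x i) / (1 - q i) / real C) = (\<Sum>i\<in>M. real (x i) / real C)"
    by (intro sum.cong) auto
  also have "\<dots> = 1"
    using assms(3,4) by (simp add: sum_divide_distrib[symmetric] flip: of_nat_sum)
  finally show ?thesis by (simp add: expectation_workload[OF assms(1,2)])
qed

lemma workload_nonneg:
  assumes "\<And>i. i \<in> M \<Longrightarrow> q i < 1"
  shows "0 \<le> workload C q M"
  unfolding workload_def using assms by (intro sum_nonneg) (auto simp: less_imp_le)

text \<open>
  Each of \<open>N \<le> m \<le> C\<close> threats gets at least \<open>m div N \<ge> (1 + m / N) / 4\<close> effectors; half of the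
  resulting exponent is spent on Markov's inequality, hence the factor \<open>1 / 8\<close> in \<open>\<beta>\<close>.
\<close>

lemma decay_steps_drift_upper:
  fixes C m :: nat and q_hi :: real
  assumes fair: "fair_allocation n C M x" and fin: "finite M" and "M \<noteq> {}"
    and q: "\<And>i. i \<in> M \<Longrightarrow> 0 < q i \<and> q i \<le> q_hi" and q_hi: "0 < q_hi" "q_hi < 1"
    and m: "card M \<le> m" "m \<le> C"
  defines "\<beta> \<equiv> - ln q_hi / 8"
  defines "a \<equiv> exp (- \<beta>)"
  shows "measure_pmf.expectation (retain (\<lambda>i. q i ^ x i) M) (\<lambda>N. real (decay_steps a \<beta> m (card N)))
    \<le> real (decay_steps a \<beta> m (card M)) - (1 - a)"
proof -
  have \<beta>: "0 < \<beta>" using q_hi by (simp add: \<beta>_def)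
  then have a: "0 < a" "a < 1" by (auto simp: a_def)
  define K where "K = card M"
  \<comment> \<open>\<open>d\<close> is the target size: a round ends below it with probability at
    least \<open>1 - a\<close>.\<close>
  define d where "d = decay a \<beta> m K"
  define e where "e = \<beta> * (1 + real m / real K)"
  have K: "1 \<le> K" using fin \<open>M \<noteq> {}\<close> by (simp add: K_def Suc_le_eq card_gt_0_iff)
  have d: "d = real K * exp (- e)"
    by (simp add: d_def decay_def a_def e_def algebra_simps flip: exp_add)
  have d_pos: "0 < d" unfolding d using K by simp
  have p: "q i ^ x i \<le> exp (- (2 * e))" if "i \<in> M" for i
  proof -
    have "m div K \<le> x i"
      using fair_allocation_ge[OF fair fin that] div_le_mono[OF m(2), of K] by (simp add: K_def)
    moreover have "1 \<le> m div K" using K m(1) by (simp add: K_def div_greater_zero_iff Suc_le_eq)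
    moreover have "real m / real K < real (m div K) + 1"
    proof -
      have "m < (m div K + 1) * K" using K by (simp add: dividend_less_div_times add.commute)
      then have "real m < real ((m div K + 1) * K)" by (simp only: of_nat_less_iff)
      then show ?thesis using K by (simp add: field_simps)
    qed
    ultimately have "1 + real m / real K \<le> 4 * real (x i)" by linarith
    then have "2 * e \<le> 8 * \<beta> * real (x i)" using \<beta> by (simp add: e_def)
    then have le: "exp (- (8 * \<beta> * real (x i))) \<le> exp (- (2 * e))" by simp
    have "q i ^ x i \<le> q_hi ^ x i" using q[OF that] by (intro power_mono) auto
    also have "\<dots> = exp (real (x i) * ln q_hi)" using q_hi by (simp add: exp_of_nat_mult)
    also have "real (x i) * ln q_hi = - (8 * \<beta> * real (x i))" by (simp add: \<beta>_def)
    finally show ?thesis using le by (rule order_trans)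
  qed
  let ?R = "retain (\<lambda>i. q i ^ x i) M"
  have p01: "q i ^ x i \<in> {0..1}" if "i \<in> M" for i
    using q[OF that] q_hi by (auto intro!: power_le_one)
  have "measure_pmf.prob ?R {N. d \<le> real (card N)} \<le> (\<Sum>i\<in>M. q i ^ x i) / d"
    by (rule prob_retain_card_ge[OF fin p01 d_pos])
  \<comment> \<open>The mean is at most \<open>K * exp (- (2 * e))\<close> and
    \<open>d = K * exp (- e)\<close>, so one factor \<open>exp (- e)\<close> remains.\<close>
  also have "\<dots> \<le> (real K * exp (- (2 * e))) / d"
    using sum_bounded_above[of M "\<lambda>i. q i ^ x i", OF p] d_pos
    by (intro divide_right_mono) (auto simp: K_def)
  also have "\<dots> = exp (- e)"
    using K by (simp add: d exp_double[symmetric] power2_eq_square exp_minus field_simps flip: exp_add)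
  also have "\<dots> \<le> a" using \<beta> by (simp add: a_def e_def)
  finally have prob: "measure_pmf.prob ?R {N. d \<le> real (card N)} \<le> a" .
  have steps: "decay_steps a \<beta> m K = Suc (decay_steps a \<beta> m d)"
    unfolding d_def using K by (intro decay_steps_Suc a \<beta>) auto
  \<comment> \<open>The count falls by at least one if fewer than \<open>d\<close> threats survive,
    and otherwise does not rise.\<close>
  have "measure_pmf.expectation ?R (\<lambda>N. real (decay_steps a \<beta> m (card N))) \<le>
      measure_pmf.expectation ?R (\<lambda>N. real (decay_steps a \<beta> m d) + indicator {N. d \<le> real (card N)} N)"
  proof (rule expectation_retain_mono[OF fin])
    fix N assume "N \<subseteq> M"
    then have "card N \<le> K" using fin by (auto simp: K_def intro: card_mono)
    then have "decay_steps a \<beta> m (card N) \<le> decay_steps a \<beta> m K"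
      by (intro decay_steps_mono a \<beta>) auto
    moreover have "decay_steps a \<beta> m (card N) \<le> decay_steps a \<beta> m d" if "\<not> d \<le> real (card N)"
      using that by (intro decay_steps_mono a \<beta>) auto
    ultimately show "real (decay_steps a \<beta> m (card N)) \<le>
        real (decay_steps a \<beta> m d) + indicator {N. d \<le> real (card N)} N"
      using steps by (cases "d \<le> real (card N)") auto
  qed
  also have "\<dots> = real (decay_steps a \<beta> m d) + measure_pmf.prob ?R {N. d \<le> real (card N)}"
    using integrable_retain[OF fin] by (subst Bochner_Integration.integral_add) auto
  also have "\<dots> \<le> real (decay_steps a \<beta> m K) - (1 - a)" using prob steps by simp
  finally show ?thesis by (simp add: K_def)
qed

text \<open>Normally a round advances by at most one step. Too few survivors have probability at
  most \<open>exp (- d)\<close> by the Chernoff bound and cost at most \<open>v \<le> exp d\<close>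
  further steps, so at most one more on average; hence the 2.\<close>

lemma decay_steps_drift_lower:
  fixes C :: nat and q_lo :: real
  assumes fair: "fair_allocation n C M x" and fin: "finite M" and "M \<noteq> {}"
    and q: "\<And>i. i \<in> M \<Longrightarrow> q_lo \<le> q i \<and> q i < 1" and q_lo: "0 < q_lo" "q_lo < 1"
  defines "\<beta> \<equiv> - ln q_lo"
  defines "a \<equiv> exp (- \<beta>) / 4"
  shows "real (decay_steps a \<beta> C (card M)) - 2 \<le>
    measure_pmf.expectation (retain (\<lambda>i. q i ^ x i) M) (\<lambda>N. real (decay_steps a \<beta> C (card N)))"
proof -
  have \<beta>: "0 < \<beta>" using q_lo by (simp add: \<beta>_def)
  then have a: "0 < a" "a < 1" "a \<le> 1 / 2"
    using exp_le_one_iff[of "- \<beta>"] by (auto simp: a_def simp del: exp_le_one_iff)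
  define K where "K = card M"
  define d where "d = decay a \<beta> C K"
  define e where "e = \<beta> * (1 + real C / real K)"
  define \<mu> where "\<mu> = (\<Sum>i\<in>M. q i ^ x i)"
  have K: "1 \<le> K" using fin \<open>M \<noteq> {}\<close> by (simp add: K_def Suc_le_eq card_gt_0_iff)
  \<comment> \<open>In \<open>a\<close>, the factor \<open>exp (- \<beta>)\<close> covers the
    rounding up of \<open>C / K\<close>, and \<open>1 / 4\<close> comes from the Chernoff
    threshold.\<close>
  have d: "d = real K * exp (- e) / 4"
    by (simp add: d_def decay_def a_def e_def algebra_simps flip: exp_add)
  have d_pos: "0 < d" unfolding d using K by simp
  have p: "exp (- e) \<le> q i ^ x i" if "i \<in> M" for i
  proof -
    have "real (x i) \<le> 1 + real C / real K"
    proof (cases "x i = 0")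
      case False
      have "real ((x i - 1) * K) \<le> real C"
        using fair_allocation_le[OF fair fin that] by (simp only: K_def of_nat_le_iff)
      then show ?thesis using K False by (simp add: of_nat_diff field_simps)
    qed simp
    then have "exp (- e) \<le> exp (- (\<beta> * real (x i)))" using \<beta> by (simp add: e_def)
    also have "\<dots> = q_lo ^ x i"
      using q_lo exp_of_nat_mult[of "x i" "ln q_lo"] by (simp add: \<beta>_def mult.commute)
    also have "\<dots> \<le> q i ^ x i" using q[OF that] q_lo by (intro power_mono) auto
    finally show ?thesis .
  qed
  let ?R = "retain (\<lambda>i. q i ^ x i) M"
  have p01: "q i ^ x i \<in> {0..1}" if "i \<in> M" for i
    using q[OF that] q_lo by (auto intro!: power_le_one)
  have d_le: "d \<le> \<mu> / 4"
    using sum_bounded_below[of M "exp (- e)" "\<lambda>i. q i ^ x i", OF p] by (simp add: d K_def \<mu>_def)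
  have "measure_pmf.prob ?R {N. real (card N) \<le> \<mu> / 4} \<le> exp (- (\<mu> / 4))"
    unfolding \<mu>_def by (rule prob_retain_card_le[OF fin p01])
  also have "\<dots> \<le> exp (- d)" using d_le by simp
  finally have prob: "measure_pmf.prob ?R {N. real (card N) \<le> \<mu> / 4} \<le> exp (- d)" .
  define v where "v = decay_steps a \<beta> C d"
  have steps: "decay_steps a \<beta> C K = Suc v"
    unfolding d_def v_def using K by (intro decay_steps_Suc a \<beta>) auto
  \<comment> \<open>With \<open>v = w + 1\<close> steps left, \<open>d\<close> is at least
    \<open>2 ^ w\<close>, which is at least \<open>v\<close>.\<close>
  have "real v * exp (- d) \<le> 1"
  proof (cases v)
    case (Suc w)
    have "1 \<le> a ^ w * d"
      using Suc d_pos by (intro power_le_of_decay_steps[OF a(1,2) \<beta>, of C]) (auto simp: v_def)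
    also have "\<dots> \<le> (1 / 2) ^ w * d" using a d_pos by (intro mult_right_mono power_mono) auto
    finally have "2 ^ w \<le> d" by (simp add: field_simps)
    moreover have "real v \<le> 2 ^ w"
    proof -
      have "v \<le> 2 ^ w" using Suc less_exp[of w] by linarith
      then show ?thesis by (metis of_nat_le_iff of_nat_numeral of_nat_power)
    qed
    ultimately have "real v \<le> exp d" using exp_ge_add_one_self[of d] by linarith
    then show ?thesis by (simp add: exp_minus field_simps)
  qed simp
  then have "real (decay_steps a \<beta> C K) - 2 \<le> real v - real v * exp (- d)" using steps by simp
  also have "\<dots> \<le> real v - real v * measure_pmf.prob ?R {N. real (card N) \<le> \<mu> / 4}"
    using prob by (simp add: mult_left_mono)
  also have "\<dots> = measure_pmf.expectation ?R
      (\<lambda>N. real v - real v * indicator {N. real (card N) \<le> \<mu> / 4} N)"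
    using integrable_retain[OF fin] by (subst Bochner_Integration.integral_diff) auto
  also have "\<dots> \<le> measure_pmf.expectation ?R (\<lambda>N. real (decay_steps a \<beta> C (card N)))"
  proof (rule expectation_retain_mono[OF fin])
    fix N assume "N \<subseteq> M"
    have "v \<le> decay_steps a \<beta> C (card N)" if "\<not> real (card N) \<le> \<mu> / 4"
      unfolding v_def using that d_le d_pos by (intro decay_steps_mono a \<beta>) auto
    then show "real v - real v * indicator {N. real (card N) \<le> \<mu> / 4} N \<le>
        real (decay_steps a \<beta> C (card N))"
      by (cases "real (card N) \<le> \<mu> / 4") auto
  qed
  finally show ?thesis by (simp add: K_def)
qed

subsection \<open>Bounds for a single instance\<close>

locale fair_instance =
  fixes q_lo q_hi :: real and n C :: nat and q :: "nat \<Rightarrow> real" and \<pi> :: policy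
  assumes q_lo: "0 < q_lo" "q_lo < 1" and q_hi: "0 < q_hi" "q_hi < 1"
    and q: "\<And>i. i \<in> {1..n} \<Longrightarrow> q_lo \<le> q i \<and> q i \<le> q_hi"
    and \<pi>: "\<pi> \<in> fair_policies n C" and n: "1 \<le> n" and C: "1 \<le> C"
begin

abbreviation "\<beta>_hi \<equiv> - ln q_hi / 8"
abbreviation "a_hi \<equiv> exp (- \<beta>_hi)"
abbreviation "\<beta>_lo \<equiv> - ln q_lo"
abbreviation "a_lo \<equiv> exp (- \<beta>_lo) / 4"

lemma q01: "i \<in> {1..n} \<Longrightarrow> 0 < q i \<and> q i < 1"
  using q[of i] q_lo q_hi by auto

lemma policy: "\<pi> \<in> policies n C"
  using \<pi> by (simp add: fair_policies_def)

lemma fair_round: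
  assumes "M \<subseteq> {1..n}" "M \<noteq> {}"
  shows "finite M" "fair_allocation n C M (\<pi> (Suc t) M)"
  using assms \<pi> by (auto simp: fair_policies_def intro: finite_subset)

lemma \<beta>_hi: "0 < \<beta>_hi" and a_hi: "0 < a_hi" "a_hi < 1"
  using q_hi by auto

lemma \<beta>_lo: "0 < \<beta>_lo" and a_lo: "0 < a_lo" "a_lo < 1"
proof -
  show "0 < \<beta>_lo" using q_lo by simp
  then have "exp (- \<beta>_lo) < 1" by simp
  then show "a_lo < 1" by linarith
  show "0 < a_lo" by simp
qed

text \<open>The decay runs with \<open>n\<close> in place of the capacity \<open>C \<ge> n\<close>,
  so the bound does not depend on \<open>C\<close>.\<close>

lemma upper_large_capacity:
  assumes "n \<le> C"
  shows "expected_defusing_time n q \<pi> \<le> real (decay_steps a_hi \<beta>_hi n n) / (1 - a_hi)"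
proof -
  define \<Phi> where "\<Phi> = (\<lambda>M :: nat set. real (decay_steps a_hi \<beta>_hi n (card M)) / (1 - a_hi))"
  have "expected_defusing_time n q \<pi> \<le> \<Phi> {1..n}"
  proof (rule expected_defusing_time_le(2)[OF q01 policy C])
    show "0 \<le> \<Phi> M" for M using a_hi by (simp add: \<Phi>_def)
    fix t and M :: "nat set" assume M: "M \<subseteq> {1..n}" "M \<noteq> {}"
    have "card M \<le> n" using card_mono[OF _ M(1)] by simp
    then have "measure_pmf.expectation (retain (\<lambda>i. q i ^ \<pi> (Suc t) M i) M)
        (\<lambda>N. real (decay_steps a_hi \<beta>_hi n (card N))) \<le> real (decay_steps a_hi \<beta>_hi n (card M)) - (1 - a_hi)"
      using M q q01 q_hi assms
      by (intro decay_steps_drift_upper[OF fair_round(2)[OF M] fair_round(1)[OF M]]) auto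
    then have "measure_pmf.expectation (retain (\<lambda>i. q i ^ \<pi> (Suc t) M i) M)
        (\<lambda>N. real (decay_steps a_hi \<beta>_hi n (card N))) / (1 - a_hi) \<le>
        (real (decay_steps a_hi \<beta>_hi n (card M)) - (1 - a_hi)) / (1 - a_hi)"
      using a_hi by (intro divide_right_mono) auto
    then show "measure_pmf.expectation (retain (\<lambda>i. q i ^ \<pi> (Suc t) M i) M) \<Phi> \<le> \<Phi> M - 1"
      using a_hi by (simp add: \<Phi>_def diff_divide_distrib)
  qed
  then show ?thesis by (simp add: \<Phi>_def)
qed

text \<open>The cap is \<open>C - 1\<close> rather than \<open>C\<close> so that the second summand vanishes for \<open>C = 1\<close>, where \<open>ln_star C = 0\<close>.\<close>

lemma upper_workload:
  shows "summable (active_prob n q \<pi>)" and "expected_defusing_time n q \<pi> \<le>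
    workload C q {1..n} + real (decay_steps a_hi \<beta>_hi C (min n (C - 1))) / (1 - a_hi)"
proof -
  define g where "g = (\<lambda>M :: nat set. real (decay_steps a_hi \<beta>_hi C (min (card M) (C - 1))))"
  define \<Phi> where "\<Phi> = (\<lambda>M :: nat set. workload C q M + g M / (1 - a_hi))"
  have nonneg: "0 \<le> \<Phi> M" if "M \<subseteq> {1..n}" for M
    using that a_hi q01 by (auto simp: \<Phi>_def g_def intro!: add_nonneg_nonneg workload_nonneg)
  have drift: "measure_pmf.expectation (retain (\<lambda>i. q i ^ \<pi> (Suc t) M i) M) \<Phi> \<le> \<Phi> M - 1"
    if M: "M \<subseteq> {1..n}" "M \<noteq> {}" for t M
  proof -
    let ?R = "retain (\<lambda>i. q i ^ \<pi> (Suc t) M i) M"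
    note fin = fair_round(1)[OF M] and fair = fair_round(2)[OF M]
    have qM: "\<And>i. i \<in> M \<Longrightarrow> 0 < q i \<and> q i < 1" using q01 M by blast
    have split: "measure_pmf.expectation ?R \<Phi> =
        measure_pmf.expectation ?R (workload C q) + measure_pmf.expectation ?R g / (1 - a_hi)"
      unfolding \<Phi>_def using integrable_retain[OF fin]
      by (subst Bochner_Integration.integral_add) auto
    show ?thesis
    proof (cases "C \<le> card M")
      case True
      \<comment> \<open>With at least \<open>C\<close> active threats the workload pays for the
        round, and \<open>g\<close> must only not increase.\<close>
      have "measure_pmf.expectation ?R (workload C q) = workload C q M - 1"
        using fair_allocation_le_1[OF fair fin _ True] fair_allocation_sum[OF fair fin]
        by (intro workload_drift_eq[OF fin qM]) (use C in auto)
      moreover have "measure_pmf.expectation ?R g \<le> measure_pmf.expectation ?R (\<lambda>_. g M)"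
      proof (rule expectation_retain_mono[OF fin])
        fix N assume "N \<subseteq> M"
        then have "card N \<le> card M" using fin by (intro card_mono)
        then show "g N \<le> g M"
          unfolding g_def of_nat_le_iff by (intro decay_steps_mono a_hi \<beta>_hi) auto
      qed
      then have "measure_pmf.expectation ?R g / (1 - a_hi) \<le> g M / (1 - a_hi)"
        using a_hi by (intro divide_right_mono) auto
      ultimately show ?thesis unfolding split by (simp add: \<Phi>_def)
    next
      case False
      \<comment> \<open>Below \<open>C\<close> the cap is inactive: \<open>g / (1 - a_hi)\<close>
        pays for the round, and the workload does not increase.\<close>
      have small: "g N = real (decay_steps a_hi \<beta>_hi C (card N))" if "N \<subseteq> M" for N
        using False card_mono[OF fin that] by (simp add: g_def min_def)
      have "measure_pmf.expectation ?R g \<le>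
          measure_pmf.expectation ?R (\<lambda>N. real (decay_steps a_hi \<beta>_hi C (card N)))"
        by (rule expectation_retain_mono[OF fin]) (simp add: small)
      also have "\<dots> \<le> real (decay_steps a_hi \<beta>_hi C (card M)) - (1 - a_hi)"
        using M q q01 q_hi False by (intro decay_steps_drift_upper[OF fair fin]) auto
      also have "\<dots> = g M - (1 - a_hi)" by (simp add: small)
      finally have "measure_pmf.expectation ?R g / (1 - a_hi) \<le> (g M - (1 - a_hi)) / (1 - a_hi)"
        using a_hi by (intro divide_right_mono) auto
      then have "measure_pmf.expectation ?R g / (1 - a_hi) \<le> g M / (1 - a_hi) - 1"
        using a_hi by (simp add: diff_divide_distrib)
      moreover have "measure_pmf.expectation ?R (workload C q) \<le> workload C q M"
        by (rule workload_drift_le[OF fin qM])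
      ultimately show ?thesis unfolding split by (simp add: \<Phi>_def)
    qed
  qed
  note bound = expected_defusing_time_le[where \<Phi> = \<Phi>, OF q01 policy C nonneg drift]
  show "summable (active_prob n q \<pi>)" by (rule bound(1))
  show "expected_defusing_time n q \<pi> \<le>
      workload C q {1..n} + real (decay_steps a_hi \<beta>_hi C (min n (C - 1))) / (1 - a_hi)"
    using bound(2) by (simp add: \<Phi>_def g_def)
qed

lemma integrable_defusing_time:
  "integrable (measure_pmf (demands n q)) (\<lambda>L. real (defusing_time n \<pi> L))"
  using has_integral_defusing_time[OF q01 policy C upper_workload(1)]
  by (simp add: has_bochner_integral_iff)

lemmas expected_ge = expected_defusing_time_ge[OF q01 policy C upper_workload(1)]

lemma lower_workload: "workload C q {1..n} \<le> expected_defusing_time n q \<pi>"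
proof (rule expected_ge)
  fix t and M :: "nat set" assume M: "M \<subseteq> {1..n}" "M \<noteq> {}"
  then show "workload C q M - 1 \<le>
      measure_pmf.expectation (retain (\<lambda>i. q i ^ \<pi> (Suc t) M i) M) (workload C q)"
    using q01 fair_round[OF M] fair_allocation_sum by (intro workload_drift_ge) blast+
qed (simp_all add: workload_def)

text \<open>The indicator of being nonempty serves as potential. The bound later absorbs additive
  constants.\<close>

lemma lower_one: "1 \<le> expected_defusing_time n q \<pi>"
proof -
  have "of_bool ({1..n} \<noteq> {}) \<le> expected_defusing_time n q \<pi>"
  proof (rule expected_ge)
    fix t and M :: "nat set" assume M: "M \<subseteq> {1..n}" "M \<noteq> {}"
    then show "of_bool (M \<noteq> {}) - 1 \<le>
        measure_pmf.expectation (retain (\<lambda>i. q i ^ \<pi> (Suc t) M i) M) (\<lambda>M. of_bool (M \<noteq> {}) :: real)"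
      by (simp add: Bochner_Integration.integral_nonneg)
  qed simp_all
  then show ?thesis using n by simp
qed

text \<open>A round may cost 2 steps in expectation, hence the halving.\<close>

lemma lower_decay_steps: "real (decay_steps a_lo \<beta>_lo C n) / 2 \<le> expected_defusing_time n q \<pi>"
proof -
  define U where "U = (\<lambda>M :: nat set. real (decay_steps a_lo \<beta>_lo C (card M)) / 2)"
  have "U {1..n} \<le> expected_defusing_time n q \<pi>"
  proof (rule expected_ge)
    show "U {} = 0" using decay_steps_eq_0[OF a_lo \<beta>_lo] by (simp add: U_def)
    fix t and M :: "nat set" assume M: "M \<subseteq> {1..n}" "M \<noteq> {}"
    have "real (decay_steps a_lo \<beta>_lo C (card M)) - 2 \<le>
        measure_pmf.expectation (retain (\<lambda>i. q i ^ \<pi> (Suc t) M i) M)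
          (\<lambda>N. real (decay_steps a_lo \<beta>_lo C (card N)))"
      using M q q01 q_lo
      by (intro decay_steps_drift_lower[OF fair_round(2)[OF M] fair_round(1)[OF M]]) auto
    then show "U M - 1 \<le> measure_pmf.expectation (retain (\<lambda>i. q i ^ \<pi> (Suc t) M i) M) U"
      by (simp add: U_def)
  qed
  then show ?thesis by (simp add: U_def)
qed

end

section \<open>Asymptotics from the bounds for single instances\<close>

theorem theorem4:
  fixes q_lo q_hi :: real
    and C :: "nat \<Rightarrow> nat"
    and q :: "nat \<Rightarrow> nat \<Rightarrow> real"
    and \<pi> :: "nat \<Rightarrow> policy"
  assumes "0 < q_lo" and "q_lo < q_hi" and "q_hi < 1"
    and "\<And>n. n \<ge> 1 \<Longrightarrow> C n \<ge> 1"
    and "\<And>n i. n \<ge> 1 \<Longrightarrow> i \<in> {1..n} \<Longrightarrow> q n i \<in> {q_lo..q_hi}"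
    and "\<And>n. n \<ge> 1 \<Longrightarrow> \<pi> n \<in> fair_policies n (C n)"
  shows "(\<forall>n\<ge>1. integrable (measure_pmf (demands n (q n))) (\<lambda>L. real (defusing_time n (\<pi> n) L))) \<and>
         ((\<forall>\<^sub>F n in sequentially. C n = n) \<longrightarrow>
           (\<lambda>n. expected_defusing_time n (q n) (\<pi> n)) \<in> \<Theta>(\<lambda>n. real (ln_star n))) \<and>
         ((\<forall>\<^sub>F n in sequentially. C n > n) \<longrightarrow>
           (\<lambda>n. expected_defusing_time n (q n) (\<pi> n)) \<in> O(\<lambda>n. real (ln_star n))) \<and>
         ((\<forall>\<^sub>F n in sequentially. C n < n) \<longrightarrow>
           (\<lambda>n. expected_defusing_time n (q n) (\<pi> n)
                 - 1 / real (C n) * (\<Sum>i\<in>{1..n}. 1 / (1 - q n i)))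
             \<in> O(\<lambda>n. real (ln_star (C n))))"
proof -
  have inst: "fair_instance q_lo q_hi n (C n) (q n) (\<pi> n)" if "n \<ge> 1" for n
    using assms that by unfold_locales auto
  define \<beta> where "\<beta> = - ln q_hi / 8"
  define a where "a = exp (- \<beta>)"
  define b where "b = - ln q_lo"
  define c where "c = exp (- b) / 4"
  have a: "0 < a" "a < 1" "0 < \<beta>" and c: "0 < c" "c < 1" "0 < b"
    using fair_instance.\<beta>_hi[OF inst] fair_instance.a_hi[OF inst]
      fair_instance.\<beta>_lo[OF inst] fair_instance.a_lo[OF inst]
    by (auto simp: a_def \<beta>_def b_def c_def)
  obtain A where A: "\<And>m. m \<ge> 1 \<Longrightarrow> decay_steps a \<beta> (real m) (real m) \<le> A + ln_star m"
    using decay_steps_le_ln_star[OF a] by blast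
  obtain B where B: "\<And>m. m \<ge> 1 \<Longrightarrow> ln_star m \<le> B + 2 * decay_steps c b (real m) (real m)"
    using ln_star_le_decay_steps[OF c] by blast
  let ?K = "(real A + 1) / (1 - a)"
  let ?E = "\<lambda>n. expected_defusing_time n (q n) (\<pi> n)"
  \<comment> \<open>For \<open>m \<ge> 2\<close> the bound \<open>ln_star m \<ge> 1\<close> turns
    the additive \<open>A\<close> into a factor.\<close>
  have steps: "real (decay_steps a \<beta> (real m) (real m)) / (1 - a) \<le> ?K * real (ln_star m)"
    if "m \<ge> 2" for m
  proof -
    have "real A * 1 \<le> real A * real (ln_star m)"
      using ln_star_ge_1[OF that] by (intro mult_left_mono) auto
    moreover have "real (decay_steps a \<beta> (real m) (real m)) \<le> real (A + ln_star m)"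
      using A[of m] that by simp
    ultimately have "real (decay_steps a \<beta> (real m) (real m)) \<le> (real A + 1) * real (ln_star m)"
      by (simp add: algebra_simps)
    then show ?thesis using a by (simp add: divide_right_mono)
  qed
  have E_ge1: "1 \<le> ?E n" if "n \<ge> 1" for n
    using fair_instance.lower_one[OF inst[OF that]] .
  have upper: "?E \<in> O(\<lambda>n. real (ln_star n))" if "\<forall>\<^sub>F n in sequentially. C n \<ge> n"
  proof (rule bigoI)
    show "\<forall>\<^sub>F n in sequentially. norm (?E n) \<le> ?K * norm (real (ln_star n))"
      using that eventually_ge_at_top[of 2]
    proof eventually_elim
      case (elim n)
      then have "n \<ge> 1" by simp
      from fair_instance.upper_large_capacity[OF inst[OF this] elim(1)] steps[OF elim(2)]
        E_ge1[OF this]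
      show ?case unfolding a_def \<beta>_def by simp
    qed
  qed
  show ?thesis
  proof (intro conjI impI allI)
    show "integrable (measure_pmf (demands n (q n))) (\<lambda>L. real (defusing_time n (\<pi> n) L))"
      if "n \<ge> 1" for n
      by (rule fair_instance.integrable_defusing_time[OF inst[OF that]])
  next
    assume *: "\<forall>\<^sub>F n in sequentially. C n = n"
    show "?E \<in> \<Theta>(\<lambda>n. real (ln_star n))"
    proof (rule bigthetaI)
      show "?E \<in> O(\<lambda>n. real (ln_star n))"
        using * by (intro upper) (auto elim: eventually_mono)
      have "(\<lambda>n. real (ln_star n)) \<in> O(?E)"
      proof (rule bigoI)
        \<comment> \<open>The 4 is 2 from \<open>ln_star_le_decay_steps\<close> times 2 from
          \<open>lower_decay_steps\<close>; \<open>B\<close> is absorbed because the expectation is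
          at least 1.\<close>
        show "\<forall>\<^sub>F n in sequentially. norm (real (ln_star n)) \<le> (real B + 4) * norm (?E n)"
          using * eventually_ge_at_top[of 1]
        proof eventually_elim
          case (elim n)
          have "real (ln_star n) \<le> real (B + 2 * decay_steps c b (real n) (real n))"
            using B[OF elim(2)] by (simp only: of_nat_le_iff)
          moreover have "real (decay_steps c b (real n) (real n)) / 2 \<le> ?E n"
            using fair_instance.lower_decay_steps[OF inst[OF elim(2)]] elim(1)
            by (simp add: c_def b_def)
          moreover have "real B * 1 \<le> real B * ?E n"
            using E_ge1[OF elim(2)] by (intro mult_left_mono) auto
          ultimately have "real (ln_star n) \<le> (real B + 4) * ?E n" by (simp add: algebra_simps)
          then show ?case using E_ge1[OF elim(2)] by simp
        qed
      qed
      then show "?E \<in> \<Omega>(\<lambda>n. real (ln_star n))" by (simp add: bigomega_iff_bigo)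
    qed
  next
    assume "\<forall>\<^sub>F n in sequentially. C n > n"
    then show "?E \<in> O(\<lambda>n. real (ln_star n))"
      by (intro upper) (auto elim: eventually_mono)
  next
    show "(\<lambda>n. ?E n - 1 / real (C n) * (\<Sum>i\<in>{1..n}. 1 / (1 - q n i))) \<in> O(\<lambda>n. real (ln_star (C n)))"
    proof (rule bigoI)
      show "\<forall>\<^sub>F n in sequentially. norm (?E n - 1 / real (C n) * (\<Sum>i\<in>{1..n}. 1 / (1 - q n i)))
          \<le> ?K * norm (real (ln_star (C n)))"
        using eventually_ge_at_top[of 1]
      proof eventually_elim
        case (elim n)
        interpret fair_instance q_lo q_hi n "C n" "q n" "\<pi> n" by (rule inst[OF elim])
        have W: "workload (C n) (q n) {1..n} = 1 / real (C n) * (\<Sum>i\<in>{1..n}. 1 / (1 - q n i))"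
          unfolding workload_def sum_divide_distrib[symmetric] by simp
        have "real (decay_steps a \<beta> (C n) (min n (C n - 1))) / (1 - a) \<le> ?K * real (ln_star (C n))"
        proof (cases "C n \<ge> 2")
          case True
          have "decay_steps a \<beta> (C n) (min n (C n - 1)) \<le> decay_steps a \<beta> (C n) (C n)"
            by (intro decay_steps_mono a) auto
          then have "real (decay_steps a \<beta> (C n) (min n (C n - 1))) / (1 - a) \<le>
              real (decay_steps a \<beta> (C n) (C n)) / (1 - a)"
            using a by (intro divide_right_mono) auto
          also have "\<dots> \<le> ?K * real (ln_star (C n))" by (rule steps[OF True])
          finally show ?thesis .
        next
          case False
          \<comment> \<open>Here \<open>C n = 1\<close> and \<open>ln_star 1 = 0\<close>, so the
            left-hand side must vanish exactly.\<close>
          then have "min n (C n - 1) = 0" by simp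
          then have "decay_steps a \<beta> (C n) (min n (C n - 1)) = 0"
            using decay_steps_eq_0[OF a] by simp
          then show ?thesis using a by simp
        qed
        \<comment> \<open>The workload is also a lower bound, so the difference is nonnegative and
          equals its norm.\<close>
        with upper_workload(2) lower_workload show ?case
          unfolding W a_def \<beta>_def by simp
      qed
    qed
  qed
qed

end
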